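(* Let $q,a$ be complex numbers with $0<|q|<1$, $a\neq 0$ and $a\notin\{q^m: m\in\mathbb{Z}\}$. Let $k$ be a positive integer, put $\kappa=2k$ and, for nonnegative integers $n_1,\dots,n_{k-1}$, $N_j=n_j+n_{j+1}+\cdots+n_{k-1}$. Then $$\sum_{n=0}^{\infty}\frac{(q;q)_{2n}\, q^n}{(a;q)_{n+1}(q/a;q)_n}\sum_{n_1,\dots,n_{k-1}=0}^{\infty}\frac{q^{N_1^2+\cdots+N_{k-1}^2+N_1+\cdots+N_{k-1}}}{(q;q)_{n-N_1}(q;q)_{n_1}\cdots(q;q)_{n_{k-2}}(q^2;q^2)_{n_{k-1}}}$$ $$=\sum_{n=0}^{\infty} a^n q^{(\kappa-1)\binom{n+1}{2}}+\sum_{i=1}^{\kappa-1} (-1)^{i+1} a^i q^{\binom{i}{2}}\frac{(q^i,q^{\kappa-i},q^{\kappa};q^{\kappa})_{\infty}}{(q,a,q/a;q)_{\infty}}\sum_{n=0}^{\infty} (-1)^n a^{\kappa n}q^{(\kappa-1)(kn+i)n}.$$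
   Context: Notation: $(x;q)_\infty=\prod_{j=0}^\infty(1-xq^j)$; $(x;q)_n=(x;q)_\infty/(xq^n;q)_\infty$ for all integers $n$ (so $(x;q)_n=\prod_{j=0}^{n-1}(1-xq^j)$ for $n\ge 0$), and $1/(q;q)_n=0$ for negative $n$; $(x_1,\dots,x_m;q)_n=(x_1;q)_n\cdots(x_m;q)_n$ (also for $n=\infty$). $\binom{i}{2}=i(i-1)/2$. For $k=1$ the inner sum (over $n_1,\dots,n_{k-1}$) is interpreted as $1/(q^2;q^2)_n$; for $k=2$ the product $(q;q)_{n_1}\cdots(q;q)_{n_{k-2}}$ is empty, equal to $1$. *)

theory Defs
  imports "HOL-Analysis.Analysis"
begin

definition qpoch_inf :: "complex \<Rightarrow> complex \<Rightarrow> complex"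
  where "qpoch_inf x q = (\<Prod>j. 1 - x * q ^ j)"

text \<open>
  The index is an integer and the definition is the quotient of infinite products. In the
  degenerate case that the denominator vanishes, the quotient is \<open>0\<close> because \<open>z / 0 = 0\<close>.
  For \<open>(q;q)\<^sub>n\<close> with negative \<open>n\<close> this yields the convention \<open>1 / (q;q)\<^sub>n = 0\<close>, see
  \<open>inverse_qpoch_neg\<close> below. For nonnegative \<open>n\<close> and nonvanishing denominator it is
  the usual finite product, see \<open>qpoch_of_nat\<close> below.
\<close>

definition qpoch :: "complex \<Rightarrow> complex \<Rightarrow> int \<Rightarrow> complex"
  where "qpoch x q n = qpoch_inf x q / qpoch_inf (x * q powi n) q"

definition tail_sum :: "nat \<Rightarrow> (nat \<Rightarrow> nat) \<Rightarrow> nat \<Rightarrow> nat"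
  where "tail_sum k \<nu> j = (\<Sum>l\<in>{j..<k}. \<nu> l)"

definition inner_term :: "complex \<Rightarrow> nat \<Rightarrow> nat \<Rightarrow> (nat \<Rightarrow> nat) \<Rightarrow> complex"
  where "inner_term q k n \<nu> =
    q ^ ((\<Sum>j\<in>{1..<k}. (tail_sum k \<nu> j)\<^sup>2) + (\<Sum>j\<in>{1..<k}. tail_sum k \<nu> j)) /
    (qpoch q q (int n - int (tail_sum k \<nu> 1)) *
     (\<Prod>j\<in>{1..<k - 1}. qpoch q q (int (\<nu> j))) *
     qpoch (q\<^sup>2) (q\<^sup>2) (int (\<nu> (k - 1))))"

text \<open>
  The tuples \<open>(n\<^sub>1, \<dots>, n\<^sub>k\<^sub>-\<^sub>1)\<close> are the functions \<open>\<nu> \<in> {1..<k} \<rightarrow>\<^sub>E UNIV\<close>. Only the finitely many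
  tuples with \<open>N\<^sub>1 \<le> n\<close> contribute (see \<open>finite_support_inner_term\<close> below). For \<open>k = 1\<close> the
  general term would refer to a nonexistent \<open>n\<^sub>0\<close>, and the sum is by convention \<open>1 / (q\<^sup>2;q\<^sup>2)\<^sub>n\<close>.
\<close>

definition inner_sum :: "complex \<Rightarrow> nat \<Rightarrow> nat \<Rightarrow> complex"
  where "inner_sum q k n =
    (if k = 1 then 1 / qpoch (q\<^sup>2) (q\<^sup>2) (int n)
     else (\<Sum>\<^sub>\<infinity>\<nu>\<in>{1..<k} \<rightarrow>\<^sub>E UNIV. inner_term q k n \<nu>))"

lemma convergent_prod_qpoch:
  fixes x q :: complex
  assumes "norm q < 1"
  shows "convergent_prod (\<lambda>j. 1 - x * q ^ j)"
proof -
  have "summable (\<lambda>j. norm x * norm q ^ j)"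
    using assms by (intro summable_mult summable_geometric) auto
  hence "summable (\<lambda>j. norm ((1 - x * q ^ j) - 1))"
    by (simp add: norm_mult norm_power)
  thus ?thesis
    by (intro abs_convergent_prod_imp_convergent_prod summable_imp_abs_convergent_prod)
qed

lemma qpoch_inf_eq_0_iff:
  assumes "norm q < 1"
  shows "qpoch_inf x q = 0 \<longleftrightarrow> (\<exists>j. x * q ^ j = 1)"
proof -
  have "qpoch_inf x q = 0 \<longleftrightarrow> (\<exists>j. 1 - x * q ^ j = 0)"
    unfolding qpoch_inf_def
    by (subst has_prod_eq_0_iff[OF convergent_prod_has_prod[OF convergent_prod_qpoch[OF assms, of x]]])
       (auto simp: image_iff)
  thus ?thesis by (metis right_minus_eq)
qed

lemma qpoch_of_nat:
  assumes "norm q < 1" and "qpoch_inf (x * q ^ n) q \<noteq> 0"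
  shows "qpoch x q (int n) = (\<Prod>j<n. 1 - x * q ^ j)"
proof -
  have "(\<lambda>j. 1 - x * q ^ j) has_prod ((\<Prod>j<n. 1 - x * q ^ j) * qpoch_inf (x * q ^ n) q)"
    using has_prod_ignore_initial_segment'[OF convergent_prod_qpoch[OF assms(1), of x], of n]
    by (simp add: qpoch_inf_def power_add mult_ac)
  hence "qpoch_inf x q = (\<Prod>j<n. 1 - x * q ^ j) * qpoch_inf (x * q ^ n) q"
    by (simp add: qpoch_inf_def has_prod_iff)
  thus ?thesis
    using assms(2) by (simp add: qpoch_def)
qed

lemma inverse_qpoch_neg:
  assumes "norm q < 1" and "q \<noteq> 0" and "n < 0"
  shows "1 / qpoch q q n = 0"
proof -
  have "q * q powi n * q ^ nat (- n - 1) = q powi 1 * q powi n * q powi (- n - 1)"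
    using assms(3) by (simp add: power_int_def)
  also have "\<dots> = q powi (1 + n + (- n - 1))"
    using assms(2) by (simp only: power_int_add[of q] simp_thms)
  finally have "q * q powi n * q ^ nat (- n - 1) = 1"
    by simp
  hence "qpoch_inf (q * q powi n) q = 0"
    using assms(1) by (subst qpoch_inf_eq_0_iff) auto
  thus ?thesis by (simp add: qpoch_def)
qed

lemma finite_support_inner_term:
  assumes "norm q < 1" and "q \<noteq> 0"
  shows "finite {\<nu> \<in> {1..<k} \<rightarrow>\<^sub>E UNIV. inner_term q k n \<nu> \<noteq> 0}"
proof (rule finite_subset)
  show "{\<nu> \<in> {1..<k} \<rightarrow>\<^sub>E UNIV. inner_term q k n \<nu> \<noteq> 0} \<subseteq> {1..<k} \<rightarrow>\<^sub>E {..n}"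
  proof safe
    fix \<nu> i
    assume nu: "\<nu> \<in> {1..<k} \<rightarrow>\<^sub>E (UNIV :: nat set)" "inner_term q k n \<nu> \<noteq> 0" and i: "i \<in> {1..<k}"
    have "\<not> int n - int (tail_sum k \<nu> 1) < 0"
    proof
      assume "int n - int (tail_sum k \<nu> 1) < 0"
      from inverse_qpoch_neg[OF assms this] nu(2) show False
        by (simp add: inner_term_def)
    qed
    moreover have "\<nu> i \<le> tail_sum k \<nu> 1"
      unfolding tail_sum_def using i by (intro member_le_sum) auto
    ultimately show "\<nu> i \<le> n" by linarith
  qed (auto simp: PiE_def extensional_def)
qed (simp add: finite_PiE)

end

theory Submission
  imports Defs "HOL-Computational_Algebra.Polynomial"
begin

text \<open>
  Multiply the identity by \<open>\<Theta> = (q, a, q/a; q)\<^sub>\<infinity>\<close> and compare coefficients of \<open>a\<^sup>M\<close>. On the left, the inner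
  sum is the \<open>\<beta>\<^sub>n\<close> of a Bailey pair relative to \<open>q\<close>: it is reached from Gauss's sum for \<open>1/(q\<^sup>2;q\<^sup>2)\<^sub>n\<close> by
  \<open>k - 1\<close> steps of the Bailey chain, each of which is the \<open>q\<close>-Vandermonde sum. The factor
  \<open>\<Theta> / ((a;q)\<^bsub>n+1\<^esub> (q/a;q)\<^sub>n) = (q, a q\<^bsup>n+1\<^esup>, q\<^bsup>n+1\<^esup>/a; q)\<^sub>\<infinity>\<close> has a Laurent expansion in \<open>a\<close> whose
  coefficients are \<open>q\<close>-series with numerators \<open>(q;q)\<^bsub>2n+m\<^esub>\<close>; collecting the terms with \<open>s = n + m\<close> fixed is
  exactly the inversion of the Bailey pair, and what remains is the partial theta function
  \<open>(-1)\<^sup>M q\<^bsup>|M|(|M|+1)/2\<^esup> \<Sum>\<^sub>s (-1)\<^sup>s q\<^bsup>k(s\<^sup>2+s)+s|M|\<^esup>\<close>. On the right, the Jacobi triple product (the case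
  \<open>n = 0\<close> of the Laurent expansion) turns \<open>\<Theta> \<Sum>\<^sub>n a\<^sup>n q\<^bsup>(2k-1)n(n+1)/2\<^esup>\<close> into a series with the same coefficients
  for \<open>M \<le> 0\<close>. For \<open>M > 0\<close> the two partial theta functions differ by a complete theta function, which the
  triple product in base \<open>q\<^bsup>2k\<^esup>\<close>, with \<open>M = i + 2kn\<close>, evaluates as \<open>(q\<^sup>i, q\<^bsup>2k-i\<^esup>, q\<^bsup>2k\<^esup>; q\<^bsup>2k\<^esup>)\<^sub>\<infinity>\<close> times a
  monomial; it vanishes for \<open>i = 0\<close>.
\<close>

section \<open>Finite sums over q-factorials: q-Pascal rules, q-Vandermonde and Gauss\<close>

locale qseries =
  fixes q :: complex
  assumes q_nonzero: "q \<noteq> 0" and norm_q: "norm q < 1"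
begin

definition qfac :: "nat \<Rightarrow> complex"
  where "qfac n = (\<Prod>j<n. 1 - q ^ Suc j)"

lemma power_neq_1: "n > 0 \<Longrightarrow> q ^ n \<noteq> 1"
  by (metis norm_q norm_ge_zero norm_one norm_power order_less_irrefl power_less_one_iff)

lemma qfac_nonzero [simp]: "qfac n \<noteq> 0"
  unfolding qfac_def using power_neq_1 by (metis (lifting) finite_lessThan prod_zero_iff right_minus_eq zero_less_Suc)

lemma qfac_0 [simp]: "qfac 0 = 1"
  by (simp add: qfac_def)

lemma qfac_Suc: "qfac (Suc n) = qfac n * (1 - q ^ Suc n)"
  by (simp add: qfac_def)

lemma one_minus_power_over_qfac:
  "(1 - q ^ Suc n) / qfac (Suc n) = 1 / qfac n"
  using power_neq_1[of "Suc n"] by (simp add: qfac_Suc del: power_Suc)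

lemma eq_one_divide_mult:
  "c \<noteq> 0 \<Longrightarrow> c * S = 1 / A \<Longrightarrow> S = 1 / (A * c :: complex)"
  by (metis divide_divide_eq_left nonzero_mult_div_cancel_left)

text \<open>This is the q-Pascal rule in summed form. Splitting 1 - q^(N+1) = (1 - q^i) + q^i (1 -
  q^(N+1-i)) lets each half cancel the last factor of one of the two q-factorials. It drives the
  inductions on finite sums below.\<close>

lemma sum_over_qfac_peel:
  "(1 - q ^ Suc N) * (\<Sum>i\<le>Suc N. f i / (qfac (Suc N - i) * qfac i)) =
    (\<Sum>i\<le>N. (f (Suc i) + q ^ i * f i) / (qfac (N - i) * qfac i))"
proof -
  let ?A = "\<lambda>i. f i * (1 - q ^ i) / (qfac (Suc N - i) * qfac i)"
  let ?B = "\<lambda>i. q ^ i * f i * (1 - q ^ (Suc N - i)) / (qfac (Suc N - i) * qfac i)"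
  have "(1 - q ^ Suc N) * (\<Sum>i\<le>Suc N. f i / (qfac (Suc N - i) * qfac i)) = (\<Sum>i\<le>Suc N. ?A i + ?B i)"
    unfolding sum_distrib_left
  proof (rule sum.cong)
    fix i assume "i \<in> {..Suc N}"
    hence "q ^ Suc N = q ^ i * q ^ (Suc N - i)"
      by (simp flip: power_add)
    hence "1 - q ^ Suc N = (1 - q ^ i) + q ^ i * (1 - q ^ (Suc N - i))"
      by (simp only: ring_distribs) simp
    thus "(1 - q ^ Suc N) * (f i / (qfac (Suc N - i) * qfac i)) = ?A i + ?B i"
      by (simp only: add_divide_distrib [symmetric] times_divide_eq_right) (simp only: ring_distribs mult_ac)
  qed simp
  also have "\<dots> = (\<Sum>i\<le>Suc N. ?A i) + (\<Sum>i\<le>Suc N. ?B i)"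
    by (rule sum.distrib)
  also have "(\<Sum>i\<le>Suc N. ?A i) = (\<Sum>i\<le>N. ?A (Suc i))"
    by (subst sum.atMost_Suc_shift) simp
  also have "\<dots> = (\<Sum>i\<le>N. f (Suc i) / (qfac (N - i) * qfac i))"
  proof (rule sum.cong)
    fix i assume "i \<in> {..N}"
    show "?A (Suc i) = f (Suc i) / (qfac (N - i) * qfac i)"
      using one_minus_power_over_qfac[of i] power_neq_1[of "Suc i"]
      by (simp add: qfac_Suc del: power_Suc)
  qed simp
  also have "(\<Sum>i\<le>Suc N. ?B i) = (\<Sum>i\<le>N. ?B i)"
    by simp
  also have "\<dots> = (\<Sum>i\<le>N. q ^ i * f i / (qfac (N - i) * qfac i))"
  proof (rule sum.cong)
    fix i assume "i \<in> {..N}"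
    hence "Suc N - i = Suc (N - i)" by simp
    thus "?B i = q ^ i * f i / (qfac (N - i) * qfac i)"
      using power_neq_1[of "Suc (N - i)"]
      by (simp add: qfac_Suc del: power_Suc)
  qed simp
  finally show ?thesis
    by (simp add: sum.distrib add_divide_distrib)
qed

text \<open>The other q-Pascal rule, obtained from \<open>sum_over_qfac_peel\<close> by reversing
  the order of summation.\<close>

lemma sum_over_qfac_peel':
  "(1 - q ^ Suc N) * (\<Sum>i\<le>Suc N. f i / (qfac (Suc N - i) * qfac i)) =
    (\<Sum>i\<le>N. (f i + q ^ (N - i) * f (Suc i)) / (qfac (N - i) * qfac i))"
proof -
  have rev: "(\<Sum>i\<le>M. h i) = (\<Sum>i\<le>M. h (M - i))" for h :: "nat \<Rightarrow> complex" and M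
    by (rule sum.reindex_bij_witness[of _ "\<lambda>i. M - i" "\<lambda>i. M - i"]) auto
  have "(\<Sum>i\<le>Suc N. f i / (qfac (Suc N - i) * qfac i)) =
      (\<Sum>i\<le>Suc N. f (Suc N - i) / (qfac (Suc N - i) * qfac i))"
    by (subst rev, rule sum.cong) (auto simp: mult_ac)
  also have "(1 - q ^ Suc N) * \<dots> =
      (\<Sum>i\<le>N. (f (Suc N - Suc i) + q ^ i * f (Suc N - i)) / (qfac (N - i) * qfac i))"
    by (rule sum_over_qfac_peel)
  also have "\<dots> = (\<Sum>i\<le>N. (f i + q ^ (N - i) * f (Suc i)) / (qfac (N - i) * qfac i))"
    by (subst rev, rule sum.cong) (auto simp: mult_ac Suc_diff_le)
  finally show ?thesis .
qed

text \<open>Peeling turns the sum for N + 1 and c into the sum for N and c + 1, so the induction on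
  N has to leave c arbitrary.\<close>

lemma q_vandermonde:
  "(\<Sum>i\<le>N. q ^ (i\<^sup>2 + i * c) / (qfac (N - i) * qfac i * qfac (i + c))) = 1 / (qfac N * qfac (N + c))"
proof (induction N arbitrary: c)
  case (Suc N)
  let ?f = "\<lambda>i. q ^ (i\<^sup>2 + i * c) / qfac (i + c)"
  have nz: "1 - q ^ Suc N \<noteq> 0"
    using power_neq_1[of "Suc N"] by simp
  have "(1 - q ^ Suc N) * (\<Sum>i\<le>Suc N. q ^ (i\<^sup>2 + i * c) / (qfac (Suc N - i) * qfac i * qfac (i + c)))
     = (1 - q ^ Suc N) * (\<Sum>i\<le>Suc N. ?f i / (qfac (Suc N - i) * qfac i))"
    by (simp only: divide_divide_eq_left mult_ac)
  also have "\<dots> = (\<Sum>i\<le>N. (?f (Suc i) + q ^ i * ?f i) / (qfac (N - i) * qfac i))"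
    by (rule sum_over_qfac_peel)
  also have "\<dots> = (\<Sum>i\<le>N. q ^ (i\<^sup>2 + i * Suc c) / (qfac (N - i) * qfac i * qfac (i + Suc c)))"
  proof (rule sum.cong)
    fix i
    have e: "(Suc i)\<^sup>2 + Suc i * c = (i\<^sup>2 + i * Suc c) + Suc (i + c)"
      by (simp add: power2_eq_square algebra_simps)
    have e2: "q ^ i * q ^ (i\<^sup>2 + i * c) = q ^ (i\<^sup>2 + i * Suc c)"
      by (simp add: add_ac flip: power_add)
    have "?f (Suc i) + q ^ i * ?f i =
        (q ^ (i\<^sup>2 + i * Suc c) * q ^ Suc (i + c)) / qfac (Suc (i + c)) + q ^ (i\<^sup>2 + i * Suc c) / qfac (i + c)"
      by (simp only: e power_add [of q "i\<^sup>2 + i * Suc c"] times_divide_eq_right e2 add_Suc)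
    also have "\<dots> = q ^ (i\<^sup>2 + i * Suc c) / qfac (Suc (i + c))"
    proof -
      have g: "x * y / (F * (1 - y)) + x / F = x / (F * (1 - y))"
        if "F \<noteq> 0" "1 - y \<noteq> 0" for x y F :: complex
        using that by (simp add: divide_simps) (simp add: algebra_simps)
      show ?thesis
        using power_neq_1[of "Suc (i + c)"] unfolding qfac_Suc by (intro g) auto
    qed
    finally show "(?f (Suc i) + q ^ i * ?f i) / (qfac (N - i) * qfac i) =
        q ^ (i\<^sup>2 + i * Suc c) / (qfac (N - i) * qfac i * qfac (i + Suc c))"
      by (simp only: divide_divide_eq_left mult_ac add_Suc_right)
  qed simp
  also have "\<dots> = 1 / (qfac N * qfac (N + Suc c))"
    by (rule Suc.IH)
  finally have "(1 - q ^ Suc N) * (\<Sum>i\<le>Suc N. q ^ (i\<^sup>2 + i * c) / (qfac (Suc N - i) * qfac i * qfac (i + c))) =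
      1 / (qfac N * qfac (N + Suc c))" .
  from eq_one_divide_mult[OF nz this] show ?case
    by (simp only: qfac_Suc[of N] mult_ac add_Suc add_Suc_right)
qed simp

definition qfac2 :: "nat \<Rightarrow> complex"
  where "qfac2 n = (\<Prod>j<n. 1 - (q\<^sup>2) ^ Suc j)"

text \<open>Gauss's alternating sum of Gaussian binomial coefficients, centred at i = n;
  \<open>powi\<close> is there because i - n may be negative before squaring. A single peel lowers
  the range by two: it leaves the factor 1 - q^(2n+1-i), which kills the term i = 2n + 1 and cancels
  a factor of the q-factorial in all the others.\<close>

lemma gauss_sum_full:
  "(\<Sum>i\<le>2 * n. (- 1) ^ (i + n) * q powi ((int i - int n)\<^sup>2) / (qfac (2 * n - i) * qfac i)) = 1 / qfac2 n"
proof (induction n)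
  case 0
  show ?case by (simp add: qfac2_def)
next
  case (Suc n)
  define f where "f = (\<lambda>n i. (- 1) ^ (i + n) * q powi ((int i - int n)\<^sup>2))"
  have nz: "1 - q ^ Suc (Suc (2 * n)) \<noteq> 0"
    using power_neq_1[of "Suc (Suc (2 * n))"] by simp
  have "(1 - q ^ Suc (Suc (2 * n))) * (\<Sum>i\<le>Suc (Suc (2 * n)). f (Suc n) i / (qfac (Suc (Suc (2 * n)) - i) * qfac i)) =
      (\<Sum>i\<le>Suc (2 * n). (f (Suc n) (Suc i) + q ^ i * f (Suc n) i) / (qfac (Suc (2 * n) - i) * qfac i))"
    by (rule sum_over_qfac_peel)
  also have "\<dots> = (\<Sum>i\<le>Suc (2 * n). f n i * (1 - q ^ (Suc (2 * n) - i)) / (qfac (Suc (2 * n) - i) * qfac i))"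
  proof (rule sum.cong)
    fix i assume "i \<in> {..Suc (2 * n)}"
    hence i: "i \<le> Suc (2 * n)" by simp
    have "q ^ i * q powi ((int i - int (Suc n))\<^sup>2) = q powi (int i + (int i - int (Suc n))\<^sup>2)"
      using q_nonzero by (simp add: power_int_add)
    also have "int i + (int i - int (Suc n))\<^sup>2 = (int i - int n)\<^sup>2 + int (Suc (2 * n) - i)"
      using i by (simp add: of_nat_diff power2_eq_square algebra_simps)
    also have "q powi \<dots> = q powi ((int i - int n)\<^sup>2) * q ^ (Suc (2 * n) - i)"
      using q_nonzero by (simp only: power_int_add power_int_of_nat simp_thms)
    finally have "q ^ i * q powi ((int i - int (Suc n))\<^sup>2) = q powi ((int i - int n)\<^sup>2) * q ^ (Suc (2 * n) - i)" .
    hence "q ^ i * f (Suc n) i = - (f n i * q ^ (Suc (2 * n) - i))"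
      by (simp add: f_def mult_ac)
    moreover have "f (Suc n) (Suc i) = f n i"
      by (simp add: f_def)
    ultimately show "(f (Suc n) (Suc i) + q ^ i * f (Suc n) i) / (qfac (Suc (2 * n) - i) * qfac i) =
        f n i * (1 - q ^ (Suc (2 * n) - i)) / (qfac (Suc (2 * n) - i) * qfac i)"
      by (simp add: algebra_simps)
  qed simp
  also have "\<dots> = (\<Sum>i\<le>2 * n. f n i / (qfac (2 * n - i) * qfac i))"
  proof -
    have "f n i * (1 - q ^ (Suc (2 * n) - i)) / (qfac (Suc (2 * n) - i) * qfac i) = f n i / (qfac (2 * n - i) * qfac i)"
      if "i \<le> 2 * n" for i
    proof -
      have "Suc (2 * n) - i = Suc (2 * n - i)" using that by simp
      thus ?thesis using power_neq_1[of "Suc (2 * n - i)"] by (simp add: qfac_Suc del: power_Suc)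
    qed
    thus ?thesis by simp
  qed
  also have "\<dots> = 1 / qfac2 n"
    using Suc.IH by (simp add: f_def)
  finally have "(1 - q ^ Suc (Suc (2 * n))) * (\<Sum>i\<le>Suc (Suc (2 * n)). f (Suc n) i / (qfac (Suc (Suc (2 * n)) - i) * qfac i)) = 1 / qfac2 n" .
  moreover have "qfac2 (Suc n) = qfac2 n * (1 - q ^ Suc (Suc (2 * n)))"
    by (simp add: qfac2_def power_mult [symmetric] power2_eq_square mult.assoc)
      (simp add: power_mult power2_eq_square)
  ultimately have "(\<Sum>i\<le>Suc (Suc (2 * n)). f (Suc n) i / (qfac (Suc (Suc (2 * n)) - i) * qfac i)) = 1 / qfac2 (Suc n)"
    using eq_one_divide_mult[OF nz] by metis
  thus ?case by (simp add: f_def)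
qed

text \<open>The full sum is symmetric about its centre: the terms at n + r and n - r both equal
  \<open>t r\<close>. Folding it there and pairing \<open>t r\<close> with \<open>t (Suc r)\<close>
  over a common denominator produces the factor 1 - q^(2r+1), which is the shape of a Bailey pair
  relative to q.\<close>

lemma gauss_sum:
  "(\<Sum>r\<le>n. (- 1) ^ r * q ^ r\<^sup>2 * (1 - q ^ (2 * r + 1)) / (qfac (n - r) * qfac (n + r + 1))) = 1 / qfac2 n"
proof -
  define g where "g = (\<lambda>i. (- 1) ^ (i + n) * q powi ((int i - int n)\<^sup>2) / (qfac (2 * n - i) * qfac i))"
  define t where "t = (\<lambda>r. (- 1) ^ r * q ^ r\<^sup>2 / (qfac (n - r) * qfac (n + r)))"
  have gp: "g (n + r) = t r" for r
  proof -
    have "2 * n - (n + r) = n - r" by simp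
    moreover have "q powi ((int (n + r) - int n)\<^sup>2) = q ^ r\<^sup>2"
      by (simp flip: of_nat_power)
    moreover have "(- 1 :: complex) ^ (n + r + n) = (- 1) ^ r"
      by (simp add: power_add)
    ultimately show ?thesis by (simp add: g_def t_def)
  qed
  have gm: "g (n - r) = t r" if "r \<le> n" for r
  proof -
    have "2 * n - (n - r) = n + r" using that by simp
    moreover have "q powi ((int (n - r) - int n)\<^sup>2) = q ^ r\<^sup>2"
      using that by (simp add: of_nat_diff flip: of_nat_power)
    moreover have "(- 1 :: complex) ^ (n - r + n) = (- 1) ^ r"
      using that by (intro minus_one_power_iff[THEN trans] trans[OF _ minus_one_power_iff[symmetric]]) auto
    ultimately show ?thesis by (simp add: g_def t_def mult_ac)
  qed
  have "(\<Sum>i\<le>2 * n. g i) = (\<Sum>i<n. g i) + (\<Sum>i\<in>{n..n+n}. g i)"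
    by (subst sum.union_disjoint [symmetric]) (auto intro!: sum.cong)
  also have "(\<Sum>i<n. g i) = (\<Sum>r<n. g (n - Suc r))"
    by (rule sum.nat_diff_reindex [symmetric])
  also have "\<dots> = (\<Sum>r<n. t (Suc r))"
    by (rule sum.cong) (use gm in auto)
  also have "(\<Sum>i\<in>{n..n+n}. g i) = (\<Sum>r\<le>n. g (n + r))"
    using sum.shift_bounds_cl_nat_ivl[of g 0 n n] by (simp add: add.commute atMost_atLeast0)
  also have "\<dots> = (\<Sum>r\<le>n. t r)"
    by (simp add: gp)
  finally have T: "(\<Sum>r<n. t (Suc r)) + (\<Sum>r\<le>n. t r) = 1 / qfac2 n"
    using gauss_sum_full[of n] by (simp add: g_def)
  \<comment> \<open>At r = n there is no partner \<open>t (Suc n)\<close>: the factor 1 - q^(2n+1)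
    cancels against the last factor of (q;q)_(2n+1) and leaves \<open>t n\<close> alone.\<close>
  have "(\<Sum>r\<le>n. (- 1) ^ r * q ^ r\<^sup>2 * (1 - q ^ (2 * r + 1)) / (qfac (n - r) * qfac (n + r + 1))) =
      (\<Sum>r\<le>n. t r + (if r < n then t (Suc r) else 0))"
  proof (rule sum.cong)
    fix r assume "r \<in> {..n}"
    hence r: "r \<le> n" by simp
    have e: "q ^ (Suc r)\<^sup>2 = q ^ r\<^sup>2 * q ^ (2 * r + 1)"
      unfolding power_add [symmetric] by (rule arg_cong[of _ _ "(^) q"]) (simp add: power2_eq_square)
    show "(- 1) ^ r * q ^ r\<^sup>2 * (1 - q ^ (2 * r + 1)) / (qfac (n - r) * qfac (n + r + 1)) =
        t r + (if r < n then t (Suc r) else 0)"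
    proof (cases "r < n")
      case True
      define m where "m = n - Suc r"
      have m: "n - r = Suc m" "n - Suc r = m" "n + r + 1 = Suc (n + r)" "n + Suc r = Suc (n + r)"
        using True by (auto simp: m_def)
      have x: "q ^ Suc (n + r) = q ^ Suc m * q ^ (2 * r + 1)"
        using True by (subst power_add [symmetric]) (simp add: m_def add.commute)
      have nz: "1 - q ^ Suc m \<noteq> 0" "1 - q ^ Suc m * q ^ (2 * r + 1) \<noteq> 0"
        using power_neq_1[of "Suc m"] power_neq_1[of "Suc (n + r)"] unfolding x by auto
      have g: "s * x * (1 - z) / (F * (1 - y) * (G * (1 - y * z))) =
          s * x / (F * (1 - y) * G) + - s * (x * z) / (F * (G * (1 - y * z)))"
        if "F \<noteq> 0" "G \<noteq> 0" "1 - y \<noteq> 0" "1 - y * z \<noteq> 0" for s x y z F G :: complex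
        using that by (simp add: divide_simps) (simp add: algebra_simps)
      show ?thesis
        using True nz by (simp only: t_def m qfac_Suc e x power_Suc[of "-1"] if_True mult_minus1) (intro g qfac_nonzero)
    next
      case False
      hence rn: "r = n" using r by simp
      have "2 * n + 1 = Suc (2 * n)" "n + n + 1 = Suc (2 * n)" "n + n = 2 * n" by simp_all
      thus ?thesis
        using power_neq_1[of "Suc (2 * n)"] by (simp add: t_def rn qfac_Suc del: power_Suc flip: mult_2)
    qed
  qed simp
  also have "\<dots> = (\<Sum>r\<le>n. t r) + (\<Sum>r<n. t (Suc r))"
    by (simp add: sum.distrib lessThan_Suc_atMost [symmetric])
  finally show ?thesis using T by (simp add: add.commute)
qed

section \<open>q-differences and the inversion of the Bailey matrix\<close>

text \<open>The N-th q-difference annihilates x^j for j < N, evaluated at x = q^t. Peeling brings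
  out the factor q^j - 1, which disposes of j = 0. For j > 0 the extra power q^(N-t) turns q^(jt)
  into q^N q^((j-1)t), so N and j drop together.\<close>

lemma q_difference_power:
  assumes "j < N"
  shows "(\<Sum>t\<le>N. (- 1) ^ (N - t) * q ^ ((N - t) choose 2) * q ^ (j * t) / (qfac (N - t) * qfac t)) = 0"
  using assms
proof (induction N arbitrary: j)
  case (Suc N)
  let ?f = "\<lambda>t. (- 1) ^ (Suc N - t) * q ^ ((Suc N - t) choose 2) * q ^ (j * t)"
  have nz: "1 - q ^ Suc N \<noteq> 0"
    using power_neq_1[of "Suc N"] by simp
  have "(1 - q ^ Suc N) * (\<Sum>t\<le>Suc N. ?f t / (qfac (Suc N - t) * qfac t)) =
      (\<Sum>t\<le>N. (?f t + q ^ (N - t) * ?f (Suc t)) / (qfac (N - t) * qfac t))"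
    by (rule sum_over_qfac_peel')
  also have "\<dots> = (\<Sum>t\<le>N. (q ^ j - 1) * q ^ (N - t) * ((- 1) ^ (N - t) * q ^ ((N - t) choose 2) * q ^ (j * t) / (qfac (N - t) * qfac t)))"
  proof (rule sum.cong)
    fix t assume "t \<in> {..N}"
    hence "Suc N - t = Suc (N - t)" by simp
    moreover have "Suc (N - t) choose 2 = (N - t) + ((N - t) choose 2)"
      by (simp add: numeral_2_eq_2)
    ultimately have "?f t + q ^ (N - t) * ?f (Suc t) =
        (q ^ j - 1) * q ^ (N - t) * ((- 1) ^ (N - t) * q ^ ((N - t) choose 2) * q ^ (j * t))"
      by (simp only: power_add power_Suc mult_Suc_right diff_Suc_Suc) (simp add: ring_distribs mult_ac)
    thus "(?f t + q ^ (N - t) * ?f (Suc t)) / (qfac (N - t) * qfac t) =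
        (q ^ j - 1) * q ^ (N - t) * ((- 1) ^ (N - t) * q ^ ((N - t) choose 2) * q ^ (j * t) / (qfac (N - t) * qfac t))"
      by (simp only: times_divide_eq_right)
  qed simp
  also have "\<dots> = 0"
  proof (cases j)
    case (Suc i)
    have "(\<Sum>t\<le>N. (q ^ j - 1) * q ^ (N - t) * ((- 1) ^ (N - t) * q ^ ((N - t) choose 2) * q ^ (j * t) / (qfac (N - t) * qfac t))) =
        (q ^ j - 1) * q ^ N * (\<Sum>t\<le>N. (- 1) ^ (N - t) * q ^ ((N - t) choose 2) * q ^ (i * t) / (qfac (N - t) * qfac t))"
      unfolding sum_distrib_left
    proof (rule sum.cong)
      fix t assume "t \<in> {..N}"
      hence "q ^ (N - t) * q ^ (j * t) = q ^ N * q ^ (i * t)"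
        by (simp add: Suc flip: power_add)
      from this[THEN arg_cong, of "\<lambda>x. x * ((q ^ j - 1) * (- 1) ^ (N - t) * q ^ ((N - t) choose 2) / (qfac (N - t) * qfac t))"]
      show "(q ^ j - 1) * q ^ (N - t) * ((- 1) ^ (N - t) * q ^ ((N - t) choose 2) * q ^ (j * t) / (qfac (N - t) * qfac t)) =
          (q ^ j - 1) * q ^ N * ((- 1) ^ (N - t) * q ^ ((N - t) choose 2) * q ^ (i * t) / (qfac (N - t) * qfac t))"
        by (simp only: times_divide_eq_right times_divide_eq_left) (simp only: mult_ac)
    qed simp
    thus ?thesis using Suc Suc.IH[of i] Suc.prems by simp
  qed simp
  finally show ?case using nz by simp
qed simp

lemma q_difference_poly:
  assumes "degree p < N"
  shows "(\<Sum>t\<le>N. (- 1) ^ (N - t) * q ^ ((N - t) choose 2) * poly p (q ^ t) / (qfac (N - t) * qfac t)) = 0"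
proof -
  have "(\<Sum>t\<le>N. (- 1) ^ (N - t) * q ^ ((N - t) choose 2) * poly p (q ^ t) / (qfac (N - t) * qfac t)) =
      (\<Sum>t\<le>N. \<Sum>j\<le>degree p. coeff p j * ((- 1) ^ (N - t) * q ^ ((N - t) choose 2) * q ^ (j * t) / (qfac (N - t) * qfac t)))"
    by (simp add: poly_altdef sum_distrib_left sum_divide_distrib power_mult [symmetric] mult_ac)
  also have "\<dots> = (\<Sum>j\<le>degree p. coeff p j * (\<Sum>t\<le>N. (- 1) ^ (N - t) * q ^ ((N - t) choose 2) * q ^ (j * t) / (qfac (N - t) * qfac t)))"
    by (subst sum.swap) (simp add: sum_distrib_left)
  also have "\<dots> = 0"
    using assms by (intro sum.neutral) (auto simp: q_difference_power)
  finally show ?thesis .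
qed

lemma qfac_add: "qfac (m + n) = qfac m * (\<Prod>j<n. 1 - q ^ (m + Suc j))"
  by (induction n) (simp_all add: qfac_Suc)

text \<open>The matrix that sends alpha to beta in a Bailey pair and the inversion matrix are
  mutually inverse. With s = r + N and n = r + t, the quotient of (q;q)_(2r+N+t) by (q;q)_(2r+t+1)
  is a polynomial in q^t of degree at most N - 1, which the N-th q-difference annihilates when N >
  0.\<close>

lemma q_orthogonality:
  assumes "r \<le> s"
  shows "(\<Sum>n\<in>{r..s}. (- 1) ^ (s - n) * q ^ ((s - n) choose 2) * qfac (s + n) / qfac (s - n) *
      ((1 - q ^ (2 * r + 1)) / (qfac (n - r) * qfac (n + r + 1)))) = (if r = s then 1 else 0)"
proof -
  obtain N where s: "s = r + N" using assms le_Suc_ex by blast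
  have eq: "(\<Sum>n\<in>{r..s}. (- 1) ^ (s - n) * q ^ ((s - n) choose 2) * qfac (s + n) / qfac (s - n) *
      ((1 - q ^ (2 * r + 1)) / (qfac (n - r) * qfac (n + r + 1)))) =
      (\<Sum>t\<le>N. (- 1) ^ (N - t) * q ^ ((N - t) choose 2) * qfac (2 * r + N + t) / qfac (N - t) *
      ((1 - q ^ (2 * r + 1)) / (qfac t * qfac (2 * r + t + 1))))"
    by (rule sum.reindex_bij_witness[of _ "\<lambda>t. t + r" "\<lambda>n. n - r"]) (auto simp: s algebra_simps mult_2)
  show ?thesis
  proof (cases N)
    case 0
    show ?thesis
      using power_neq_1[of "Suc (2 * r)"] unfolding eq 0 by (simp add: s qfac_Suc 0 binomial_eq_0 del: power_Suc)
  next
    case (Suc d)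
    define p where "p = (\<Prod>j<d. [:1, - (q ^ (2 * r + Suc (Suc j))):])"
    have "degree p \<le> (\<Sum>j<d. degree [:1, - (q ^ (2 * r + Suc (Suc j))):])"
      unfolding p_def using degree_prod_sum_le[of "{..<d}" "\<lambda>j. [:1, - (q ^ (2 * r + Suc (Suc j))):]"]
      by (simp add: o_def)
    also have "\<dots> \<le> (\<Sum>j<d. 1)"
      by (intro sum_mono) simp
    finally have deg: "degree p < N" by (simp add: Suc)
    have "(\<Sum>t\<le>N. (- 1) ^ (N - t) * q ^ ((N - t) choose 2) * qfac (2 * r + N + t) / qfac (N - t) *
      ((1 - q ^ (2 * r + 1)) / (qfac t * qfac (2 * r + t + 1)))) =
      (\<Sum>t\<le>N. (1 - q ^ (2 * r + 1)) * ((- 1) ^ (N - t) * q ^ ((N - t) choose 2) * poly p (q ^ t) / (qfac (N - t) * qfac t)))"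
    proof (rule sum.cong)
      fix t
      have "qfac (2 * r + N + t) = qfac (2 * r + t + 1) * poly p (q ^ t)"
        using qfac_add[of "2 * r + t + 1" d]
        by (simp add: Suc p_def poly_prod power_add mult_ac add_ac)
      hence "qfac (2 * r + N + t) / qfac (2 * r + t + 1) = poly p (q ^ t)"
        by simp
      from this[symmetric]
      show "(- 1) ^ (N - t) * q ^ ((N - t) choose 2) * qfac (2 * r + N + t) / qfac (N - t) *
      ((1 - q ^ (2 * r + 1)) / (qfac t * qfac (2 * r + t + 1))) =
        (1 - q ^ (2 * r + 1)) * ((- 1) ^ (N - t) * q ^ ((N - t) choose 2) * poly p (q ^ t) / (qfac (N - t) * qfac t))"
        by (simp only: times_divide_eq_right times_divide_eq_left divide_divide_eq_left divide_divide_eq_right) (simp only: mult_ac)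
    qed simp
    also have "\<dots> = 0"
      unfolding sum_distrib_left [symmetric] q_difference_poly[OF deg] by simp
    finally show ?thesis using eq by (simp add: s Suc)
  qed
qed


section \<open>The inner sum as an iterate of the Bailey chain\<close>

lemma qpoch_inf_power_nonzero: "qpoch_inf (q ^ Suc n) q \<noteq> 0"
  using norm_q power_neq_1[of "Suc n + _"]
  by (subst qpoch_inf_eq_0_iff) (auto simp flip: power_add simp del: power_Suc)

lemma qpoch_self_eq_qfac: "qpoch q q (int n) = qfac n"
  using qpoch_inf_power_nonzero[of n] by (subst qpoch_of_nat) (auto simp: norm_q qfac_def)

lemma qpoch_square_eq_qfac2: "qpoch (q\<^sup>2) (q\<^sup>2) (int n) = qfac2 n"
proof -
  have "q\<^sup>2 \<noteq> 0" "norm (q\<^sup>2) < 1"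
    using q_nonzero norm_q by (auto simp: norm_power power_less_one_iff)
  then interpret sq: qseries "q\<^sup>2" by unfold_locales
  show ?thesis
    using sq.qpoch_self_eq_qfac[of n] by (simp add: sq.qfac_def qfac2_def)
qed

text \<open>
  The \<open>\<beta>\<close>-sequence of a Bailey pair relative to \<open>q\<close> with
  \<open>\<alpha>\<^sub>r = (-1)\<^sup>r q\<^bsup>K(r\<^sup>2+r)+r\<^sup>2\<^esup> (1 - q\<^bsup>2r+1\<^esup>) / (1 - q)\<close>. Raising \<open>K\<close> by one is one step along the
  Bailey chain, which adds one variable to the inner sum.
\<close>

definition bailey_beta :: "nat \<Rightarrow> nat \<Rightarrow> complex"
  where "bailey_beta K n =
    (\<Sum>r\<le>n. (- 1) ^ r * q ^ (K * (r\<^sup>2 + r) + r\<^sup>2) * (1 - q ^ (2 * r + 1)) / (qfac (n - r) * qfac (n + r + 1)))"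

lemma bailey_beta_0: "bailey_beta 0 n = 1 / qfac2 n"
  using gauss_sum[of n] by (simp add: bailey_beta_def)

text \<open>One step of the Bailey chain. After exchanging the sums and shifting N = r + i, the sum
  over i is \<open>q_vandermonde\<close> with c = 2r + 1; the shift leaves behind q^(r^2+r), which
  raises K by one.\<close>

lemma bailey_beta_Suc:
  "bailey_beta (Suc K) n = (\<Sum>N\<le>n. q ^ (N\<^sup>2 + N) / qfac (n - N) * bailey_beta K N)"
proof -
  define c where "c = (\<lambda>r. (- 1) ^ r * q ^ (K * (r\<^sup>2 + r) + r\<^sup>2) * (1 - q ^ (2 * r + 1)))"
  have "(\<Sum>N\<le>n. q ^ (N\<^sup>2 + N) / qfac (n - N) * bailey_beta K N) =
      (\<Sum>N\<le>n. \<Sum>r\<le>N. q ^ (N\<^sup>2 + N) / qfac (n - N) * (c r / (qfac (N - r) * qfac (N + r + 1))))"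
    unfolding bailey_beta_def sum_distrib_left c_def ..
  also have "\<dots> = (\<Sum>r\<le>n. \<Sum>N\<in>{r..n}. q ^ (N\<^sup>2 + N) / qfac (n - N) * (c r / (qfac (N - r) * qfac (N + r + 1))))"
    unfolding sum.Sigma[OF finite_atMost ballI[OF finite_atMost]] sum.Sigma[OF finite_atMost ballI[OF finite_atLeastAtMost]]
    by (rule sum.reindex_bij_witness[of _ prod.swap prod.swap]) auto
  also have "\<dots> = (\<Sum>r\<le>n. c r * q ^ (r\<^sup>2 + r) / (qfac (n - r) * qfac (n + r + 1)))"
  proof (rule sum.cong)
    fix r assume "r \<in> {..n}"
    then obtain m where n: "n = r + m" using le_Suc_ex by auto
    have "(\<Sum>N\<in>{r..n}. q ^ (N\<^sup>2 + N) / qfac (n - N) * (c r / (qfac (N - r) * qfac (N + r + 1)))) =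
        (\<Sum>i\<le>m. c r * q ^ (r\<^sup>2 + r) * (q ^ (i\<^sup>2 + i * (2 * r + 1)) / (qfac (m - i) * qfac i * qfac (i + (2 * r + 1)))))"
    proof (rule sum.reindex_bij_witness[of _ "\<lambda>i. r + i" "\<lambda>N. N - r"])
      fix N assume "N \<in> {r..n}"
      then obtain i where N: "N = r + i" using le_Suc_ex by auto
      have e: "q ^ (N\<^sup>2 + N) = q ^ (r\<^sup>2 + r) * q ^ (i\<^sup>2 + i * (2 * r + 1))"
        unfolding N power_add [symmetric]
        by (rule arg_cong[of _ _ "(^) q"]) (simp add: power2_eq_square algebra_simps)
      have f: "N - r = i" "n - N = m - i" "N + r + 1 = i + (2 * r + 1)"
        by (auto simp: N n)
      show "c r * q ^ (r\<^sup>2 + r) * (q ^ ((N - r)\<^sup>2 + (N - r) * (2 * r + 1)) /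
          (qfac (m - (N - r)) * qfac (N - r) * qfac (N - r + (2 * r + 1)))) =
          q ^ (N\<^sup>2 + N) / qfac (n - N) * (c r / (qfac (N - r) * qfac (N + r + 1)))"
        unfolding e f by (simp only: times_divide_times_eq times_divide_eq_right times_divide_eq_left divide_divide_eq_left mult_ac)
    qed (auto simp: n)
    also have "\<dots> = c r * q ^ (r\<^sup>2 + r) / (qfac (n - r) * qfac (n + r + 1))"
      unfolding sum_distrib_left [symmetric] q_vandermonde by (simp add: n mult_2 add_ac)
    finally show "(\<Sum>N\<in>{r..n}. q ^ (N\<^sup>2 + N) / qfac (n - N) * (c r / (qfac (N - r) * qfac (N + r + 1)))) =
        c r * q ^ (r\<^sup>2 + r) / (qfac (n - r) * qfac (n + r + 1))" .
  qed simp
  also have "\<dots> = bailey_beta (Suc K) n"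
    unfolding bailey_beta_def c_def
    by (rule sum.cong) (simp_all add: power_add mult_ac)
  finally show ?thesis ..
qed

text \<open>The entries start at an arbitrary index l instead of 1, so that removing the first entry
  gives a tuple of the same kind.\<close>

definition bounded_tuples :: "nat \<Rightarrow> nat \<Rightarrow> nat \<Rightarrow> (nat \<Rightarrow> nat) set"
  where "bounded_tuples k l n = {\<nu> \<in> {l..<k} \<rightarrow>\<^sub>E UNIV. tail_sum k \<nu> l \<le> n}"

lemma finite_bounded_tuples: "finite (bounded_tuples k l n)"
proof (rule finite_subset)
  show "bounded_tuples k l n \<subseteq> {l..<k} \<rightarrow>\<^sub>E {..n}"
  proof
    fix \<nu> assume nu: "\<nu> \<in> bounded_tuples k l n"
    have "\<nu> i \<le> n" if "i \<in> {l..<k}" for i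
    proof -
      have "\<nu> i \<le> tail_sum k \<nu> l"
        unfolding tail_sum_def using that by (intro member_le_sum) auto
      thus ?thesis using nu by (simp add: bounded_tuples_def)
    qed
    thus "\<nu> \<in> {l..<k} \<rightarrow>\<^sub>E {..n}"
      using nu by (auto simp: bounded_tuples_def PiE_iff)
  qed
qed (simp add: finite_PiE)

text \<open>The summand of the inner sum with entries starting at l. The subtraction of natural
  numbers is exact on \<open>bounded_tuples k l n\<close>.\<close>

definition tuple_weight :: "nat \<Rightarrow> nat \<Rightarrow> nat \<Rightarrow> (nat \<Rightarrow> nat) \<Rightarrow> complex"
  where "tuple_weight k l n \<nu> =
    q ^ (\<Sum>j\<in>{l..<k}. (tail_sum k \<nu> j)\<^sup>2 + tail_sum k \<nu> j) /
    (qfac (n - tail_sum k \<nu> l) * (\<Prod>j\<in>{l..<k - 1}. qfac (\<nu> j)) * qfac2 (\<nu> (k - 1)))"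

lemma tail_sum_Suc: "l < k \<Longrightarrow> tail_sum k \<nu> l = \<nu> l + tail_sum k \<nu> (Suc l)"
  unfolding tail_sum_def by (rule sum.atLeast_Suc_lessThan)

lemma tail_sum_fun_upd: "l < j \<Longrightarrow> tail_sum k (\<nu>(l := x)) j = tail_sum k \<nu> j"
  unfolding tail_sum_def by (rule sum.cong) auto

text \<open>Induction on the number of variables. The first variable n_l is traded for the tail sum
  N = N_l, which becomes the bound for the remaining variables; summing over N is then exactly
  \<open>bailey_beta_Suc\<close>.\<close>

lemma sum_tuple_weight:
  "k = l + Suc K \<Longrightarrow> (\<Sum>\<nu>\<in>bounded_tuples k l n. tuple_weight k l n \<nu>) = bailey_beta (Suc K) n"
proof (induction K arbitrary: l n)
  case 0
  have ts: "tail_sum (Suc l) \<nu> l = \<nu> l" for \<nu>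
    by (simp add: tail_sum_def)
  have "(\<Sum>\<nu>\<in>bounded_tuples k l n. tuple_weight k l n \<nu>) = (\<Sum>N\<le>n. q ^ (N\<^sup>2 + N) / qfac (n - N) * (1 / qfac2 N))"
    by (rule sum.reindex_bij_witness[of _ "\<lambda>N i. if i = l then N else undefined" "\<lambda>\<nu>. \<nu> l"])
      (use 0 in \<open>auto simp: bounded_tuples_def tuple_weight_def ts fun_eq_iff PiE_iff extensional_def\<close>)
  thus ?case by (simp add: bailey_beta_Suc bailey_beta_0)
next
  case (Suc K)
  let ?g = "\<lambda>\<nu>. tail_sum k \<nu> (Suc l)"
  have lk: "l < k" "l < k - 1" "l \<noteq> k - 1" using Suc.prems by auto
  have gl: "?g (\<nu>(l := x)) = ?g \<nu>" for \<nu> x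
    by (simp add: tail_sum_fun_upd)
  have "(\<Sum>\<nu>\<in>bounded_tuples k l n. tuple_weight k l n \<nu>) =
      (\<Sum>(N, \<mu>)\<in>Sigma {..n} (\<lambda>N. bounded_tuples k (Suc l) N). q ^ (N\<^sup>2 + N) / qfac (n - N) * tuple_weight k (Suc l) N \<mu>)"
  \<comment> \<open>Resetting entry l to \<open>undefined\<close> makes the tuple extensional on the
    shorter index set. The inverse restores n_l as N - N_(l+1), which is no truncated subtraction
    because N_(l+1) is at most N.\<close>
  proof (rule sum.reindex_bij_witness[of _ "\<lambda>(N, \<mu>). \<mu>(l := N - ?g \<mu>)" "\<lambda>\<nu>. (tail_sum k \<nu> l, \<nu>(l := undefined))"])
    fix \<nu> assume nu: "\<nu> \<in> bounded_tuples k l n"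
    show "(case (tail_sum k \<nu> l, \<nu>(l := undefined)) of (N, \<mu>) \<Rightarrow> \<mu>(l := N - ?g \<mu>)) = \<nu>"
      by (simp add: tail_sum_Suc[OF lk(1)] gl)
    show "(tail_sum k \<nu> l, \<nu>(l := undefined)) \<in> Sigma {..n} (\<lambda>N. bounded_tuples k (Suc l) N)"
      using nu unfolding bounded_tuples_def by (auto simp: gl tail_sum_Suc[OF lk(1)] PiE_iff extensional_def)
    define e where "e = (\<Sum>j\<in>{Suc l..<k}. (tail_sum k \<nu> j)\<^sup>2 + tail_sum k \<nu> j)"
    have e1: "(\<Sum>j\<in>{l..<k}. (tail_sum k \<nu> j)\<^sup>2 + tail_sum k \<nu> j) = ((tail_sum k \<nu> l)\<^sup>2 + tail_sum k \<nu> l) + e"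
      unfolding e_def by (rule sum.atLeast_Suc_lessThan[OF lk(1)])
    have e2: "(\<Sum>j\<in>{Suc l..<k}. (tail_sum k (\<nu>(l := undefined)) j)\<^sup>2 + tail_sum k (\<nu>(l := undefined)) j) = e"
      unfolding e_def by (rule sum.cong) (auto simp: tail_sum_fun_upd)
    have p1: "(\<Prod>j\<in>{l..<k - 1}. qfac (\<nu> j)) = qfac (\<nu> l) * (\<Prod>j\<in>{Suc l..<k - 1}. qfac (\<nu> j))"
      by (rule prod.atLeast_Suc_lessThan[OF lk(2)])
    have p2: "(\<Prod>j\<in>{Suc l..<k - 1}. qfac ((\<nu>(l := undefined)) j)) = (\<Prod>j\<in>{Suc l..<k - 1}. qfac (\<nu> j))"
      by (rule prod.cong) auto
    have d: "tail_sum k \<nu> l - ?g (\<nu>(l := undefined)) = \<nu> l"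
      by (simp add: gl tail_sum_Suc[OF lk(1)])
    have u: "(\<nu>(l := undefined)) (k - 1) = \<nu> (k - 1)"
      using lk by simp
    show "(case (tail_sum k \<nu> l, \<nu>(l := undefined)) of
        (N, \<mu>) \<Rightarrow> q ^ (N\<^sup>2 + N) / qfac (n - N) * tuple_weight k (Suc l) N \<mu>) = tuple_weight k l n \<nu>"
      unfolding tuple_weight_def prod.case e1 e2 p1 p2 d u power_add[of q _ e]
      by (simp only: times_divide_times_eq mult_ac)
  next
    fix b assume b: "b \<in> Sigma {..n} (\<lambda>N. bounded_tuples k (Suc l) N)"
    obtain N \<mu> where b': "b = (N, \<mu>)" by force
    have mu: "N \<le> n" "?g \<mu> \<le> N" "\<mu> \<in> {Suc l..<k} \<rightarrow>\<^sub>E UNIV"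
      using b by (auto simp: b' bounded_tuples_def)
    hence "\<mu> l = undefined" by (auto simp: PiE_iff extensional_def)
    hence "\<mu>(l := undefined) = \<mu>" by (metis fun_upd_triv)
    thus "(tail_sum k (case b of (N, \<mu>) \<Rightarrow> \<mu>(l := N - ?g \<mu>)) l, (case b of (N, \<mu>) \<Rightarrow> \<mu>(l := N - ?g \<mu>))(l := undefined)) = b"
      using mu by (simp add: b' tail_sum_Suc[OF lk(1)] gl)
    show "(case b of (N, \<mu>) \<Rightarrow> \<mu>(l := N - ?g \<mu>)) \<in> bounded_tuples k l n"
      using mu lk by (auto simp: b' bounded_tuples_def tail_sum_Suc[OF lk(1)] gl PiE_iff extensional_def)
  qed
  also have "\<dots> = (\<Sum>N\<le>n. \<Sum>\<mu>\<in>bounded_tuples k (Suc l) N. q ^ (N\<^sup>2 + N) / qfac (n - N) * tuple_weight k (Suc l) N \<mu>)"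
    by (rule sum.Sigma [symmetric]) (simp_all add: finite_bounded_tuples)
  also have "\<dots> = (\<Sum>N\<le>n. q ^ (N\<^sup>2 + N) / qfac (n - N) * bailey_beta (Suc K) N)"
    unfolding sum_distrib_left [symmetric] using Suc.prems by (subst Suc.IH) simp_all
  also have "\<dots> = bailey_beta (Suc (Suc K)) n"
    by (rule bailey_beta_Suc [symmetric])
  finally show ?case .
qed

text \<open>Tuples with N_1 > n drop out since 1/(q;q)_m = 0 for negative m, so the infinite sum is
  the finite one above. There are K = k - 1 variables, that is, K steps of the chain starting from
  \<open>bailey_beta_0\<close>.\<close>

lemma inner_sum_eq_bailey_beta: "inner_sum q (Suc K) n = bailey_beta K n"
proof (cases K)
  case 0
  thus ?thesis by (simp add: inner_sum_def qpoch_square_eq_qfac2 bailey_beta_0)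
next
  case (Suc M)
  let ?k = "Suc K"
  have "inner_sum q ?k n = (\<Sum>\<^sub>\<infinity>\<nu>\<in>{1..<?k} \<rightarrow>\<^sub>E UNIV. inner_term q ?k n \<nu>)"
    using Suc by (simp add: inner_sum_def)
  also have "\<dots> = (\<Sum>\<^sub>\<infinity>\<nu>\<in>bounded_tuples ?k 1 n. inner_term q ?k n \<nu>)"
  proof (rule infsum_cong_neutral)
    fix \<nu> assume nu: "\<nu> \<in> ({1..<?k} \<rightarrow>\<^sub>E UNIV) - bounded_tuples ?k 1 n"
    hence "int n - int (tail_sum ?k \<nu> 1) < 0"
      by (auto simp: bounded_tuples_def)
    hence "1 / qpoch q q (int n - int (tail_sum ?k \<nu> 1)) = 0"
      using inverse_qpoch_neg[OF norm_q q_nonzero] by blast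
    thus "inner_term q ?k n \<nu> = 0"
      by (simp add: inner_term_def)
  qed (auto simp: bounded_tuples_def)
  also have "\<dots> = (\<Sum>\<^sub>\<infinity>\<nu>\<in>bounded_tuples ?k 1 n. tuple_weight ?k 1 n \<nu>)"
  proof (rule infsum_cong)
    fix \<nu> assume nu: "\<nu> \<in> bounded_tuples ?k 1 n"
    hence "int n - int (tail_sum ?k \<nu> 1) = int (n - tail_sum ?k \<nu> 1)"
      by (simp add: bounded_tuples_def)
    thus "inner_term q ?k n \<nu> = tuple_weight ?k 1 n \<nu>"
      by (simp only: inner_term_def tuple_weight_def qpoch_self_eq_qfac qpoch_square_eq_qfac2 sum.distrib)
  qed
  also have "\<dots> = (\<Sum>\<nu>\<in>bounded_tuples ?k 1 n. tuple_weight ?k 1 n \<nu>)"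
    by (rule infsum_finite[OF finite_bounded_tuples])
  also have "\<dots> = bailey_beta K n"
    using Suc by (subst sum_tuple_weight[of _ 1 M]) simp_all
  finally show ?thesis .
qed

text \<open>Recovers alpha_s of the Bailey pair, up to the factor (1 - q^(2s+1)) / (1 - q): after
  exchanging the sums, \<open>q_orthogonality\<close> leaves only r = s.\<close>

lemma bailey_inversion:
  "(\<Sum>n\<le>s. (- 1) ^ (s - n) * q ^ ((s - n) choose 2) * qfac (s + n) / qfac (s - n) * bailey_beta K n) =
    (- 1) ^ s * q ^ (K * (s\<^sup>2 + s) + s\<^sup>2)"
proof -
  let ?A = "\<lambda>r. (- 1) ^ r * q ^ (K * (r\<^sup>2 + r) + r\<^sup>2)"
  let ?g = "\<lambda>n. (- 1) ^ (s - n) * q ^ ((s - n) choose 2) * qfac (s + n) / qfac (s - n)"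
  let ?h = "\<lambda>n r. (1 - q ^ (2 * r + 1)) / (qfac (n - r) * qfac (n + r + 1))"
  have "(\<Sum>n\<le>s. ?g n * bailey_beta K n) = (\<Sum>n\<le>s. \<Sum>r\<le>n. ?A r * (?g n * ?h n r))"
    unfolding bailey_beta_def sum_distrib_left
    by (intro sum.cong refl) (simp only: times_divide_eq_right times_divide_eq_left divide_divide_eq_left mult_ac)
  also have "\<dots> = (\<Sum>r\<le>s. \<Sum>n\<in>{r..s}. ?A r * (?g n * ?h n r))"
    unfolding sum.Sigma[OF finite_atMost ballI[OF finite_atMost]] sum.Sigma[OF finite_atMost ballI[OF finite_atLeastAtMost]]
    by (rule sum.reindex_bij_witness[of _ prod.swap prod.swap]) auto
  also have "\<dots> = (\<Sum>r\<le>s. ?A r * (if r = s then 1 else 0))"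
    unfolding sum_distrib_left [symmetric]
    by (intro sum.cong refl, subst q_orthogonality) auto
  also have "\<dots> = ?A s"
    by (simp add: if_distrib cong: if_cong)
  finally show ?thesis .
qed

end

section \<open>Summability tools for series with quadratic exponents and for sums over the
  integers\<close>

text \<open>The ratio of consecutive terms is r \<rho>^(n+1), which tends to 0: a quadratic exponent
  beats any geometric growth.\<close>

lemma summable_power_times_triangle:
  fixes r \<rho> :: real
  assumes "0 \<le> r" "0 \<le> \<rho>" "\<rho> < 1"
  shows "summable (\<lambda>n. r ^ n * \<rho> ^ triangle n)"
proof -
  have "(\<lambda>n. r * \<rho> ^ Suc n) \<longlonglongrightarrow> r * 0"
    using assms by (intro tendsto_intros LIMSEQ_Suc LIMSEQ_power_zero) auto
  hence "eventually (\<lambda>n. r * \<rho> ^ Suc n < 1 / 2) sequentially"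
    by (intro order_tendstoD(2)) auto
  then obtain N where N: "\<And>n. n \<ge> N \<Longrightarrow> r * \<rho> ^ Suc n < 1 / 2"
    by (auto simp: eventually_at_top_linorder)
  show ?thesis
  proof (rule summable_ratio_test[of "1 / 2" N])
    fix n assume "n \<ge> N"
    have "r ^ Suc n * \<rho> ^ triangle (Suc n) = (r * \<rho> ^ Suc n) * (r ^ n * \<rho> ^ triangle n)"
      by (simp add: power_add mult_ac)
    also have "\<dots> \<le> 1 / 2 * (r ^ n * \<rho> ^ triangle n)"
      using N[OF \<open>n \<ge> N\<close>] assms by (intro mult_right_mono) auto
    finally show "norm (r ^ Suc n * \<rho> ^ triangle (Suc n)) \<le> 1 / 2 * norm (r ^ n * \<rho> ^ triangle n)"
      using assms by (simp add: abs_mult)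
  qed simp
qed

lemma summable_on_norm_bound:
  fixes f :: "'a \<Rightarrow> complex" and g :: "'a \<Rightarrow> real"
  assumes "g summable_on A" "\<And>x. x \<in> A \<Longrightarrow> norm (f x) \<le> g x"
  shows "f summable_on A"
  by (rule abs_summable_summable, rule summable_on_comparison_test[OF assms(1)]) (simp_all add: assms(2))

lemma summable_on_mult_Times:
  fixes f g :: "_ \<Rightarrow> real"
  assumes "f summable_on A" "g summable_on B" "\<And>x. x \<in> A \<Longrightarrow> f x \<ge> 0" "\<And>y. y \<in> B \<Longrightarrow> g y \<ge> 0"
  shows "(\<lambda>(x, y). f x * g y) summable_on A \<times> B"
proof (rule summable_on_SigmaI)
  show "((\<lambda>y. case (x, y) of (x, y) \<Rightarrow> f x * g y) has_sum f x * infsum g B) B" for x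
    using assms(2) by (simp add: has_sum_cmult_right)
  show "(\<lambda>x. f x * infsum g B) summable_on A"
    using assms(1) by (rule summable_on_cmult_left)
qed (use assms in auto)

lemma has_sum_int_split:
  fixes f :: "int \<Rightarrow> 'a :: topological_comm_monoid_add"
  assumes "((\<lambda>n. f (int (Suc n))) has_sum S) UNIV" "((\<lambda>n. f (- int n)) has_sum T) UNIV"
  shows "(f has_sum (S + T)) UNIV"
proof -
  have "bij_betw (\<lambda>n. int (Suc n)) UNIV {1..}"
    by (rule bij_betwI[of _ _ _ "\<lambda>m. nat (m - 1)"]) auto
  hence 1: "(f has_sum S) {1..}"
    using assms(1) has_sum_reindex_bij_betw by blast
  have "bij_betw (\<lambda>n. - int n) UNIV {..0}"
    by (rule bij_betwI[of _ _ _ "\<lambda>m. nat (- m)"]) auto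
  hence 2: "(f has_sum T) {..0}"
    using assms(2) has_sum_reindex_bij_betw by blast
  have "{1..} \<union> {..0} = (UNIV :: int set)" "{1..} \<inter> {..0} = ({} :: int set)" by auto
  thus ?thesis using has_sum_Un_disjoint[OF 1 2] by simp
qed

lemma summable_on_int_split:
  fixes f :: "int \<Rightarrow> 'a :: topological_comm_monoid_add"
  assumes "(\<lambda>n. f (int (Suc n))) summable_on UNIV" "(\<lambda>n. f (- int n)) summable_on UNIV"
  shows "f summable_on UNIV"
  using assms unfolding summable_on_def by (elim exE) (rule exI, rule has_sum_int_split)

lemma summable_on_powi_times_triangle:
  fixes r \<rho> :: real
  assumes "0 \<le> r" "0 \<le> \<rho>" "\<rho> < 1"
  shows "(\<lambda>M::int. r powi M * \<rho> ^ triangle (nat \<bar>M\<bar>)) summable_on UNIV"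
proof (rule summable_on_int_split)
  have "summable (\<lambda>n. r ^ Suc n * \<rho> ^ triangle (Suc n))"
    using summable_power_times_triangle[OF assms] by (subst summable_Suc_iff)
  thus "(\<lambda>n. r powi int (Suc n) * \<rho> ^ triangle (nat \<bar>int (Suc n)\<bar>)) summable_on UNIV"
    using assms by (subst summable_on_UNIV_nonneg_real_iff) (simp_all del: power_Suc triangle_Suc of_nat_Suc)
  show "(\<lambda>n. r powi (- int n) * \<rho> ^ triangle (nat \<bar>- int n\<bar>)) summable_on UNIV"
    using summable_power_times_triangle[of "inverse r" \<rho>] assms
    by (subst summable_on_UNIV_nonneg_real_iff) (simp_all add: power_int_minus power_inverse)
qed

section \<open>The series \<open>phi\<close>: bounds, contiguous relation and limit\<close>

context qseries
begin

abbreviation qfac_inf :: complex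
  where "qfac_inf \<equiv> qpoch_inf q q"

lemma qfac_inf_nonzero: "qfac_inf \<noteq> 0"
  using qpoch_inf_power_nonzero[of 0] by simp

lemma qfac_tendsto: "qfac \<longlonglongrightarrow> qfac_inf"
proof -
  have "(\<lambda>n. \<Prod>j\<le>n. 1 - q * q ^ j) \<longlonglongrightarrow> qfac_inf"
    unfolding qpoch_inf_def by (rule convergent_prod_LIMSEQ[OF convergent_prod_qpoch[OF norm_q]])
  hence "(\<lambda>n. qfac (Suc n)) \<longlonglongrightarrow> qfac_inf"
    by (simp add: qfac_def lessThan_Suc_atMost)
  thus ?thesis by (rule LIMSEQ_imp_Suc)
qed

text \<open>Both (q;q)_n and its reciprocal converge because the limit is nonzero. The common
  constant makes the later majorants uniform in n.\<close>

lemma qfac_bounds: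
  obtains C where "C \<ge> 1" "\<And>n. norm (qfac n) \<le> C" "\<And>n. norm (1 / qfac n) \<le> C"
proof -
  have "Bseq qfac"
    using qfac_tendsto by (intro convergent_imp_Bseq convergentI)
  then obtain C1 where C1: "\<And>n. norm (qfac n) \<le> C1" by (auto simp: Bseq_def)
  have "(\<lambda>n. 1 / qfac n) \<longlonglongrightarrow> 1 / qfac_inf"
    using qfac_inf_nonzero by (intro tendsto_intros qfac_tendsto)
  hence "Bseq (\<lambda>n. 1 / qfac n)"
    by (intro convergent_imp_Bseq convergentI)
  then obtain C2 where C2: "\<And>n. norm (1 / qfac n) \<le> C2" by (auto simp: Bseq_def)
  show ?thesis
    using C1 C2 by (intro that[of "max 1 (max C1 C2)"]) (auto simp: le_max_iff_disj)
qed

text \<open>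
  The coefficients \<open>(-1)\<^sup>m q\<^bsup>m(m+1)/2\<^esup> (z;q)\<^sub>m / (q;q)\<^sub>m\<close> for \<open>z = q\<^bsup>2n+1\<^esup>\<close>, where
  \<open>(z;q)\<^sub>m = (q;q)\<^bsub>2n+m\<^esub> / (q;q)\<^bsub>2n\<^esub>\<close>.
\<close>

definition phi_coeff :: "nat \<Rightarrow> nat \<Rightarrow> complex"
  where "phi_coeff n m = (- 1) ^ m * q ^ triangle m * qfac (2 * n + m) / (qfac (2 * n) * qfac m)"

text \<open>In standard notation this is the basic hypergeometric series 1phi1(q^(2n+1); 0; q,
  qy).\<close>

definition phi :: "nat \<Rightarrow> complex \<Rightarrow> complex"
  where "phi n y = (\<Sum>m. phi_coeff n m * y ^ m)"

lemma phi_coeff_bound: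
  obtains C where "C \<ge> 0" "\<And>n m. norm (phi_coeff n m) \<le> C * norm q ^ triangle m"
proof -
  obtain C where C: "C \<ge> 1" "\<And>n. norm (qfac n) \<le> C" "\<And>n. norm (1 / qfac n) \<le> C"
    using qfac_bounds by blast
  have "norm (phi_coeff n m) \<le> (C * C * C) * norm q ^ triangle m" for n m
  proof -
    have "norm (phi_coeff n m) = norm q ^ triangle m * (norm (qfac (2 * n + m)) * norm (1 / qfac (2 * n)) * norm (1 / qfac m))"
      by (simp add: phi_coeff_def norm_mult norm_divide norm_power)
    also have "\<dots> \<le> norm q ^ triangle m * (C * C * C)"
      using C(1) by (intro mult_left_mono mult_mono C mult_nonneg_nonneg) auto
    finally show ?thesis by (simp add: mult_ac)
  qed
  thus ?thesis using C(1) that[of "C * C * C"] by auto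
qed

lemma summable_norm_phi: "summable (\<lambda>m. norm (phi_coeff n m * y ^ m))"
proof -
  obtain C where C: "C \<ge> 0" "\<And>n m. norm (phi_coeff n m) \<le> C * norm q ^ triangle m"
    using phi_coeff_bound by blast
  show ?thesis
  proof (rule summable_comparison_test')
    show "summable (\<lambda>m. C * (norm y ^ m * norm q ^ triangle m))"
      using norm_q by (intro summable_mult summable_power_times_triangle) auto
    show "norm (norm (phi_coeff n m * y ^ m)) \<le> C * (norm y ^ m * norm q ^ triangle m)" for m
      using mult_right_mono[OF C(2)[of n m], of "norm y ^ m"] by (simp add: norm_mult norm_power mult_ac)
  qed
qed

lemma phi_sums: "(\<lambda>m. phi_coeff n m * y ^ m) sums phi n y"
  unfolding phi_def by (rule summable_sums, rule summable_norm_cancel, rule summable_norm_phi)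

lemma phi_bound:
  obtains C where "C \<ge> 0" "\<And>n y. norm y \<le> 1 \<Longrightarrow> norm (phi n y) \<le> C"
proof -
  obtain C where C: "C \<ge> 0" "\<And>n m. norm (phi_coeff n m) \<le> C * norm q ^ triangle m"
    using phi_coeff_bound by blast
  have s: "summable (\<lambda>m. C * norm q ^ triangle m)"
    using summable_power_times_triangle[of 1 "norm q"] norm_q by (intro summable_mult) auto
  have bound: "norm (phi n y) \<le> (\<Sum>m. C * norm q ^ triangle m)" if y: "norm y \<le> 1" for n y
    unfolding phi_def
  proof (rule norm_suminf_le[OF _ s])
    fix m
    have "norm (phi_coeff n m * y ^ m) \<le> norm (phi_coeff n m) * 1"
      unfolding norm_mult norm_power by (intro mult_left_mono power_le_one norm_ge_zero y)
    thus "norm (phi_coeff n m * y ^ m) \<le> C * norm q ^ triangle m"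
      using C(2)[of n m] by simp
  qed
  have "(\<Sum>m. C * norm q ^ triangle m) \<ge> 0"
    using C(1) by (intro suminf_nonneg s) simp
  thus ?thesis using bound by (rule that)
qed

lemma phi_coeff_0: "phi_coeff n 0 = 1"
  by (simp add: phi_coeff_def)

lemma phi_coeff_rec_1:
  "phi_coeff n 1 = phi_coeff (Suc n) 1 / q + (1 + q ^ (2 * n + 2)) * phi_coeff (Suc n) 0"
proof -
  have nz: "1 - q \<noteq> 0" using power_neq_1[of 1] by simp
  have 1: "phi_coeff n 1 = - q * (1 - q ^ Suc (2 * n)) / (1 - q)" for n
    by (simp add: phi_coeff_def qfac_Suc numeral_eq_Suc)
  have 2: "q ^ Suc (2 * Suc n) = q ^ (2 * n + 2) * q" "q ^ Suc (2 * n) * q = q ^ (2 * n + 2)"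
    by (simp_all add: power_add mult_ac)
  have "- q * (1 - x) / (1 - q) = - q * (1 - y * q) / (1 - q) / q + (1 + y) * 1" if "x * q = y" for x y
    using nz q_nonzero that by (auto simp: divide_simps) (simp add: algebra_simps)
  from this[OF 2(2)] show ?thesis
    by (simp only: 1 2(1) phi_coeff_0)
qed

text \<open>This is \<open>phi_rec\<close> at the level of coefficients. All q-factorials involved
  differ by a few factors, so with z = q^(2n+1) and u = q^m everything becomes rational in z, u and
  q.\<close>

lemma phi_coeff_rec:
  "phi_coeff n (Suc (Suc m)) = phi_coeff (Suc n) (Suc (Suc m)) / q ^ Suc (Suc m) +
    (1 + q ^ (2 * n + 2)) * phi_coeff (Suc n) (Suc m) + q ^ (2 * n + 3) * phi_coeff (Suc n) m * q ^ m"
proof -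
  define z u T s F E H where d: "z = q ^ Suc (2 * n)" "u = q ^ m" "T = q ^ triangle m" "s = (- 1 :: complex) ^ m"
    "F = qfac (Suc (Suc (2 * n + m)))" "E = qfac (2 * n)" "H = qfac m"
  have u0: "u \<noteq> 0" "E \<noteq> 0" "H \<noteq> 0" "q \<noteq> 0" using q_nonzero by (simp_all add: d)
  have e: "q ^ Suc m = u * q" "q ^ Suc (Suc m) = u * q * q" "q ^ Suc (Suc (2 * n)) = z * q"
    "q ^ Suc (Suc (Suc (2 * n + m))) = z * u * q * q"
    "q ^ Suc (Suc (Suc (Suc (2 * n + m)))) = z * u * q * q * q"
    "q ^ (2 * n + 2) = z * q" "q ^ (2 * n + 3) = z * q * q"
    "q ^ triangle (Suc m) = T * u * q" "q ^ triangle (Suc (Suc m)) = T * u * u * q * q * q"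
    by (simp_all add: d power_add mult_ac numeral_eq_Suc)
  have nz: "1 - z \<noteq> 0" "1 - z * q \<noteq> 0" "1 - u * q \<noteq> 0" "1 - u * q * q \<noteq> 0"
    using power_neq_1[of "Suc (2 * n)"] power_neq_1[of "Suc (Suc (2 * n))"] power_neq_1[of "Suc m"] power_neq_1[of "Suc (Suc m)"]
    unfolding e d(1)[symmetric] by auto
  have i: "2 * Suc n = Suc (Suc (2 * n))" "2 * n + Suc (Suc m) = Suc (Suc (2 * n + m))"
    "Suc (Suc (2 * n)) + Suc (Suc m) = Suc (Suc (Suc (Suc (2 * n + m))))"
    "Suc (Suc (2 * n)) + Suc m = Suc (Suc (Suc (2 * n + m)))" "Suc (Suc (2 * n)) + m = Suc (Suc (2 * n + m))"
    by simp_all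
  have E2: "qfac (Suc (Suc (2 * n))) = E * (1 - z) * (1 - z * q)"
    by (simp only: qfac_Suc[of "Suc (2 * n)"] qfac_Suc[of "2 * n"] d(1)[symmetric] d(6)[symmetric] e)
  have H1: "qfac (Suc m) = H * (1 - u * q)" and H2: "qfac (Suc (Suc m)) = H * (1 - u * q) * (1 - u * q * q)"
    by (simp_all only: qfac_Suc[of "Suc m"] qfac_Suc[of m] d(7)[symmetric] e)
  have F1: "qfac (Suc (Suc (Suc (2 * n + m)))) = F * (1 - z * u * q * q)"
    and F2: "qfac (Suc (Suc (Suc (Suc (2 * n + m))))) = F * (1 - z * u * q * q) * (1 - z * u * q * q * q)"
    by (simp_all only: qfac_Suc[of "Suc (Suc (Suc (2 * n + m)))"] qfac_Suc[of "Suc (Suc (2 * n + m))"] d(5)[symmetric] e)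
  have s: "(- 1 :: complex) ^ Suc m = - s" "(- 1 :: complex) ^ Suc (Suc m) = s"
    by (simp_all add: d)
  \<comment> \<open>Once the common factor \<open>K\<close> is taken out, the recurrence is this
    polynomial identity.\<close>
  have id: "u * q * q * ((1 - z) * (1 - z * q)) =
      (1 - z * u * q * q) * (1 - z * u * q * q * q) - (1 + z * q) * (1 - z * u * q * q) * (1 - u * q * q)
        + z * q * (1 - u * q) * (1 - u * q * q)"
    by (simp add: algebra_simps)
  define K where "K = s * T * u * q * F / (E * (1 - z) * (1 - z * q) * (H * (1 - u * q) * (1 - u * q * q)))"
  have t0: "s * (T * u * u * q * q * q) * F / (E * (H * (1 - u * q) * (1 - u * q * q))) =
      K * (u * q * q * ((1 - z) * (1 - z * q)))"
    using u0 nz by (simp add: K_def divide_simps)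
  have t1: "s * (T * u * u * q * q * q) * (F * (1 - z * u * q * q) * (1 - z * u * q * q * q)) /
      (E * (1 - z) * (1 - z * q) * (H * (1 - u * q) * (1 - u * q * q))) / (u * q * q) =
      K * ((1 - z * u * q * q) * (1 - z * u * q * q * q))"
    using u0 nz by (simp add: K_def divide_simps)
  have t2: "(1 + z * q) * (- s * (T * u * q) * (F * (1 - z * u * q * q)) / (E * (1 - z) * (1 - z * q) * (H * (1 - u * q)))) =
      - (K * ((1 + z * q) * (1 - z * u * q * q) * (1 - u * q * q)))"
    using u0 nz by (simp add: K_def divide_simps)
  have t3: "z * q * q * (s * T * F / (E * (1 - z) * (1 - z * q) * H)) * u =
      K * (z * q * (1 - u * q) * (1 - u * q * q))"
    using u0 nz by (simp add: K_def divide_simps)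
  show ?thesis
    unfolding phi_coeff_def i E2 H1 H2 F1 F2 s e d(2-7)[symmetric] t0 t1 t2 t3 unfolding id
    by (simp only: ring_distribs) simp
qed

text \<open>A contiguous relation that links n to n + 1. At y = q^p the arguments y/q, y and yq are
  those of three neighbouring Laurent coefficients, so it will express multiplication by one pair of
  linear factors.\<close>

lemma phi_rec:
  "phi n y = phi (Suc n) (y / q) + (1 + q ^ (2 * n + 2)) * y * phi (Suc n) y + q ^ (2 * n + 3) * y\<^sup>2 * phi (Suc n) (y * q)"
proof -
  define f A B C where d: "f = (\<lambda>m. phi_coeff n m * y ^ m)" "A = (\<lambda>m. phi_coeff (Suc n) m * (y / q) ^ m)"
    "B = (\<lambda>m. phi_coeff (Suc n) m * y ^ m)" "C = (\<lambda>m. phi_coeff (Suc n) m * (y * q) ^ m)"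
  have "f sums phi n y" "A sums phi (Suc n) (y / q)" "B sums phi (Suc n) y" "C sums phi (Suc n) (y * q)"
    unfolding d by (rule phi_sums)+
  note s = this
  let ?S = "(phi (Suc n) (y / q) - A 0 - A 1) + (1 + q ^ (2 * n + 2)) * y * (phi (Suc n) y - B 0) + q ^ (2 * n + 3) * y\<^sup>2 * phi (Suc n) (y * q)"
  have "(\<lambda>m. A (Suc (Suc m)) + (1 + q ^ (2 * n + 2)) * y * B (Suc m) + q ^ (2 * n + 3) * y\<^sup>2 * C m) sums ?S"
  proof (intro sums_add sums_mult)
    have "(\<lambda>m. A (Suc m)) sums (phi (Suc n) (y / q) - A 0)"
      using s(2) by (subst sums_Suc_iff) simp
    thus "(\<lambda>m. A (Suc (Suc m))) sums (phi (Suc n) (y / q) - A 0 - A 1)"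
      by (subst sums_Suc_iff) simp
    show "(\<lambda>m. B (Suc m)) sums (phi (Suc n) y - B 0)"
      using s(3) by (subst sums_Suc_iff) simp
  qed (fact s(4))
  also have "(\<lambda>m. A (Suc (Suc m)) + (1 + q ^ (2 * n + 2)) * y * B (Suc m) + q ^ (2 * n + 3) * y\<^sup>2 * C m) = (\<lambda>m. f (Suc (Suc m)))"
  proof
    fix m
    show "A (Suc (Suc m)) + (1 + q ^ (2 * n + 2)) * y * B (Suc m) + q ^ (2 * n + 3) * y\<^sup>2 * C m = f (Suc (Suc m))"
      unfolding d phi_coeff_rec[of n m]
      by (simp add: power_divide power_mult_distrib power2_eq_square ring_distribs mult_ac)
  qed
  finally have "(\<lambda>m. f (Suc (Suc m))) sums ?S" .
  hence "(\<lambda>m. f (Suc m)) sums (?S + f 1)"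
    using sums_Suc_iff[of "\<lambda>m. f (Suc m)" ?S] by (simp only: One_nat_def)
  hence "f sums (?S + f 1 + f 0)"
    by (rule sums_Suc_iff[THEN iffD1])
  from sums_unique2[OF s(1) this] have "phi n y = ?S + f 1 + f 0" .
  moreover have "f 0 = A 0"
    by (simp add: d phi_coeff_0)
  moreover have "f 1 = A 1 + (1 + q ^ (2 * n + 2)) * y * B 0"
    unfolding d phi_coeff_rec_1[of n] by (simp add: ring_distribs)
  ultimately show ?thesis
    by (simp add: algebra_simps)
qed

text \<open>At Laurent index 0 the contiguous relation calls for the argument 1/q, that is, for
  index -1. This reflection identifies it with index 1.\<close>

lemma phi_inverse_q: "phi n (1 / q) = q ^ (2 * n + 1) * phi n q"
proof -
  \<comment> \<open>Chosen so that the difference of the two series telescopes: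
    \<open>e m - e (Suc m)\<close> is the difference of their m-th terms, while
    \<open>e 0 = 0\<close> and \<open>e\<close> tends to 0.\<close>
  define e where "e = (\<lambda>m. (- 1) ^ m * q ^ triangle m / q ^ m * qfac (2 * n + m) * (1 - q ^ m) / (qfac (2 * n) * qfac m))"
  have "(\<lambda>m. phi_coeff n m * (1 / q) ^ m - q ^ (2 * n + 1) * (phi_coeff n m * q ^ m)) sums
      (phi n (1 / q) - q ^ (2 * n + 1) * phi n q)"
    by (intro sums_diff sums_mult phi_sums)
  also have "(\<lambda>m. phi_coeff n m * (1 / q) ^ m - q ^ (2 * n + 1) * (phi_coeff n m * q ^ m)) = (\<lambda>m. e m - e (Suc m))"
  proof
    fix m
    have x: "q ^ Suc (2 * n + m) = q ^ (2 * n + 1) * q ^ m"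
      by (simp add: power_add)
    have "e (Suc m) = - ((- 1) ^ m * q ^ triangle m * (qfac (2 * n + m) * (1 - q ^ Suc (2 * n + m))) / (qfac (2 * n) * qfac m))"
      using power_neq_1[of "Suc m"] q_nonzero
      by (simp add: e_def qfac_Suc power_add del: power_Suc) (simp add: power_add)
    also have "\<dots> = - ((- 1) ^ m * q ^ triangle m * qfac (2 * n + m) / (qfac (2 * n) * qfac m) * (1 - q ^ (2 * n + 1) * q ^ m))"
      unfolding x by (simp only: times_divide_eq_left times_divide_eq_right mult_ac)
    finally have e1: "e (Suc m) = - (phi_coeff n m * (1 - q ^ (2 * n + 1) * q ^ m))"
      by (simp only: phi_coeff_def)
    have e0: "e m = phi_coeff n m * ((1 / q) ^ m * (1 - q ^ m))"
      by (simp add: e_def phi_coeff_def power_divide)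
    have "(1 / q) ^ m * (1 - q ^ m) = (1 / q) ^ m - 1"
      using q_nonzero by (simp add: power_divide field_simps)
    thus "phi_coeff n m * (1 / q) ^ m - q ^ (2 * n + 1) * (phi_coeff n m * q ^ m) = e m - e (Suc m)"
      unfolding e0 e1 by (simp only: ring_distribs) simp
  qed
  finally have 1: "(\<lambda>m. e m - e (Suc m)) sums (phi n (1 / q) - q ^ (2 * n + 1) * phi n q)" .
  have "e = (\<lambda>m. phi_coeff n m * (1 / q) ^ m * (1 - q ^ m))"
    by (simp add: e_def phi_coeff_def power_divide fun_eq_iff)
  moreover have "(\<lambda>m. phi_coeff n m * (1 / q) ^ m * (1 - q ^ m)) \<longlonglongrightarrow> 0 * (1 - 0)"
    using norm_q by (intro tendsto_intros summable_LIMSEQ_zero[OF sums_summable[OF phi_sums]] LIMSEQ_power_zero)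
  ultimately have "e \<longlonglongrightarrow> 0" by simp
  from telescope_sums'[OF this] have "(\<lambda>m. e m - e (Suc m)) sums (e 0 - 0)"
    by simp
  with 1 have "phi n (1 / q) - q ^ (2 * n + 1) * phi n q = e 0"
    using sums_unique2 by fastforce
  thus ?thesis by (simp add: e_def)
qed


text \<open>An instance of the finite q-binomial theorem for (q;q)_N, divided by (q;q)_N. Peeling
  reproduces the same summand with the factor 1 - q^(N+1), which then cancels.\<close>

lemma finite_euler_sum: "(\<Sum>i\<le>N. (- 1) ^ i * q ^ triangle i / (qfac (N - i) * qfac i)) = 1"
proof (induction N)
  case (Suc N)
  let ?f = "\<lambda>i. (- 1) ^ i * q ^ triangle i"
  have nz: "1 - q ^ Suc N \<noteq> 0"
    using power_neq_1[of "Suc N"] by simp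
  have "(1 - q ^ Suc N) * (\<Sum>i\<le>Suc N. ?f i / (qfac (Suc N - i) * qfac i)) =
      (\<Sum>i\<le>N. (?f i + q ^ (N - i) * ?f (Suc i)) / (qfac (N - i) * qfac i))"
    by (rule sum_over_qfac_peel')
  also have "\<dots> = (\<Sum>i\<le>N. (1 - q ^ Suc N) * (?f i / (qfac (N - i) * qfac i)))"
  proof (rule sum.cong)
    fix i assume "i \<in> {..N}"
    hence "q ^ Suc N = q ^ (N - i) * q ^ Suc i"
      by (simp flip: power_add)
    hence "?f i + q ^ (N - i) * ?f (Suc i) = (1 - q ^ Suc N) * ?f i"
      by (simp only: triangle_Suc power_add power_Suc[of "-1"]) (simp only: ring_distribs mult_ac, simp)
    thus "(?f i + q ^ (N - i) * ?f (Suc i)) / (qfac (N - i) * qfac i) = (1 - q ^ Suc N) * (?f i / (qfac (N - i) * qfac i))"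
      by (simp only: times_divide_eq_right)
  qed simp
  also have "\<dots> = (1 - q ^ Suc N) * 1"
    unfolding sum_distrib_left [symmetric] Suc.IH ..
  finally show ?case using nz mult_cancel_left by blast
qed simp

text \<open>Euler's expansion of (q;q)_\<infinity>: the limit of \<open>finite_euler_sum\<close> by
  Tannery's theorem, where 1/(q;q)_(N-m) tends to 1/(q;q)_\<infinity> for each fixed m.\<close>

lemma euler_sum: "(\<Sum>m. (- 1) ^ m * q ^ triangle m / qfac m) = qfac_inf"
proof -
  define t where "t = (\<lambda>m. (- 1) ^ m * q ^ triangle m / qfac m)"
  define e where "e = (\<lambda>m N. if m \<le> N then t m / qfac (N - m) else 0)"
  obtain C where C: "C \<ge> 1" "\<And>n. norm (qfac n) \<le> C" "\<And>n. norm (1 / qfac n) \<le> C"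
    using qfac_bounds by blast
  have bound: "norm (e m N) \<le> C * C * norm q ^ triangle m" for m N
  proof (cases "m \<le> N")
    case True
    have "norm (e m N) = norm q ^ triangle m * (norm (1 / qfac m) * norm (1 / qfac (N - m)))"
      using True by (simp add: e_def t_def norm_mult norm_divide norm_power)
    also have "\<dots> \<le> norm q ^ triangle m * (C * C)"
      using C(1) by (intro mult_left_mono mult_mono C) auto
    finally show ?thesis by (simp add: mult_ac)
  qed (use C(1) in \<open>simp add: e_def\<close>)
  have "eventually (\<lambda>N. summable (\<lambda>m. norm (e m N))) sequentially \<and> summable (\<lambda>m. norm (t m / qfac_inf)) \<and>
      (\<lambda>N. suminf (\<lambda>m. e m N)) \<longlonglongrightarrow> suminf (\<lambda>m. t m / qfac_inf)"
  proof (rule tannerys_theorem)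
    show "(\<lambda>N. e m N) \<longlonglongrightarrow> t m / qfac_inf" for m
    proof (rule LIMSEQ_offset[of _ m])
      show "(\<lambda>N. e m (N + m)) \<longlonglongrightarrow> t m / qfac_inf"
        unfolding e_def using qfac_inf_nonzero by (simp add: tendsto_divide qfac_tendsto)
    qed
    show "\<forall>\<^sub>F (m, N) in at_top \<times>\<^sub>F sequentially. norm (e m N) \<le> C * C * norm q ^ triangle m"
      using bound by (intro always_eventually) auto
    show "summable (\<lambda>m. C * C * norm q ^ triangle m)"
      using summable_power_times_triangle[of 1 "norm q"] norm_q by (intro summable_mult) auto
  qed simp
  moreover have "suminf (\<lambda>m. e m N) = 1" for N
  proof -
    have "suminf (\<lambda>m. e m N) = (\<Sum>m\<le>N. e m N)"
      by (rule suminf_finite) (auto simp: e_def)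
    also have "\<dots> = (\<Sum>m\<le>N. (- 1) ^ m * q ^ triangle m / (qfac (N - m) * qfac m))"
      by (rule sum.cong) (auto simp: e_def t_def)
    finally show ?thesis by (simp add: finite_euler_sum)
  qed
  ultimately have s: "summable (\<lambda>m. norm (t m / qfac_inf))" "(\<lambda>N. 1) \<longlonglongrightarrow> suminf (\<lambda>m. t m / qfac_inf)"
    by simp_all
  have "suminf (\<lambda>m. t m / qfac_inf) = 1"
    by (rule LIMSEQ_unique[OF s(2) tendsto_const])
  moreover have "summable t"
    using summable_mult2[OF summable_norm_cancel[OF s(1)], of qfac_inf] qfac_inf_nonzero by simp
  ultimately have "suminf t / qfac_inf = 1"
    by (simp add: suminf_divide)
  thus ?thesis using qfac_inf_nonzero by (simp add: t_def)
qed

text \<open>For fixed m the quotient (q;q)_(2n+m) / (q;q)_(2n) tends to 1, so \<open>phi n 1\<close>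
  tends termwise to Euler's series. The bound on the coefficients is uniform in n, and Tannery's
  theorem applies.\<close>

lemma phi_1_tendsto: "(\<lambda>n. phi n 1) \<longlonglongrightarrow> qfac_inf"
proof -
  obtain C where C: "C \<ge> 0" "\<And>n m. norm (phi_coeff n m) \<le> C * norm q ^ triangle m"
    using phi_coeff_bound by blast
  have "eventually (\<lambda>n. summable (\<lambda>m. norm (phi_coeff n m))) sequentially \<and>
      summable (\<lambda>m. norm ((- 1) ^ m * q ^ triangle m / qfac m)) \<and>
      (\<lambda>n. suminf (\<lambda>m. phi_coeff n m)) \<longlonglongrightarrow> suminf (\<lambda>m. (- 1) ^ m * q ^ triangle m / qfac m)"
  proof (rule tannerys_theorem)
    fix m
    have "(\<lambda>n. qfac (2 * n + m)) \<longlonglongrightarrow> qfac_inf" for m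
      by (rule filterlim_compose[OF qfac_tendsto], rule filterlim_at_top_mono[OF filterlim_ident]) auto
    from this[of m] this[of 0]
    have "(\<lambda>n. phi_coeff n m) \<longlonglongrightarrow> (- 1) ^ m * q ^ triangle m * qfac_inf / (qfac_inf * qfac m)"
      unfolding phi_coeff_def using qfac_inf_nonzero by (intro tendsto_intros) auto
    thus "(\<lambda>n. phi_coeff n m) \<longlonglongrightarrow> (- 1) ^ m * q ^ triangle m / qfac m"
      using qfac_inf_nonzero by simp
  next
    show "\<forall>\<^sub>F (m, n) in at_top \<times>\<^sub>F sequentially. norm (phi_coeff n m) \<le> C * norm q ^ triangle m"
      using C(2) by (intro always_eventually) auto
    show "summable (\<lambda>m. C * norm q ^ triangle m)"
      using summable_power_times_triangle[of 1 "norm q"] norm_q by (intro summable_mult) auto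
  qed simp
  thus ?thesis by (simp add: phi_def euler_sum)
qed

text \<open>
  The coefficient of \<open>a\<^bsup>\<plusminus>N\<^esup>\<close> in the Laurent expansion of \<open>(q, a q\<^bsup>n+1\<^esup>, q\<^bsup>n+1\<^esup>/a; q)\<^sub>\<infinity>\<close>, see
  \<open>theta_eq\<close> below.
\<close>

definition theta_coeff :: "nat \<Rightarrow> nat \<Rightarrow> complex"
  where "theta_coeff n N = (- 1) ^ N * q ^ (triangle N + n * N) * phi n (q ^ N)"

section \<open>Laurent expansion of the product (q, a q^(n+1), q^(n+1)/a; q)_\<infinity>\<close>

text \<open>\<open>phi_rec\<close> at y = q^(p+1), multiplied by the monomial \<open>W\<close>: the
  powers of q in the relation are precisely those that separate the prefactors of the neighbouring
  coefficients.\<close>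

lemma theta_coeff_rec_Suc:
  "theta_coeff n (Suc p) = (1 + q ^ (2 * n + 2)) * theta_coeff (Suc n) (Suc p) -
    q ^ Suc n * (theta_coeff (Suc n) p + theta_coeff (Suc n) (Suc (Suc p)))"
proof -
  define W where "W = (- 1) ^ Suc p * q ^ (triangle (Suc p) + n * Suc p)"
  have y: "q ^ Suc p / q = q ^ p" "q ^ Suc p * q = q ^ Suc (Suc p)"
    using q_nonzero by simp_all
  have 0: "theta_coeff n (Suc p) = W * phi n (q ^ Suc p)"
    by (simp only: theta_coeff_def W_def)
  have 1: "theta_coeff (Suc n) (Suc p) = W * (q ^ Suc p * phi (Suc n) (q ^ Suc p))"
    by (simp add: theta_coeff_def W_def power_add mult_ac)
  have 2: "q ^ Suc n * theta_coeff (Suc n) p = - (W * phi (Suc n) (q ^ p))"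
    by (simp add: theta_coeff_def W_def power_add mult_ac)
  have "Suc n + (triangle (Suc (Suc p)) + Suc n * Suc (Suc p)) =
      (triangle (Suc p) + n * Suc p) + ((2 * n + 3) + Suc p * 2)"
    by simp
  from this[THEN arg_cong[of _ _ "(^) q"]]
  have "q ^ Suc n * q ^ (triangle (Suc (Suc p)) + Suc n * Suc (Suc p)) =
      q ^ (triangle (Suc p) + n * Suc p) * (q ^ (2 * n + 3) * (q ^ Suc p)\<^sup>2)"
    by (simp only: power_add power_mult)
  from this[THEN arg_cong[of _ _ "\<lambda>x. x * ((- 1) ^ p * phi (Suc n) (q ^ Suc (Suc p)))"]]
  have 3: "q ^ Suc n * theta_coeff (Suc n) (Suc (Suc p)) =
      - (W * (q ^ (2 * n + 3) * (q ^ Suc p)\<^sup>2 * phi (Suc n) (q ^ Suc (Suc p))))"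
    unfolding theta_coeff_def W_def power_Suc[of "-1"] mult_minus_left mult_minus_right mult_1_left minus_minus
    by (simp only: mult_ac)
  show ?thesis
    unfolding 0 1 phi_rec[of n "q ^ Suc p"] y distrib_left[of "q ^ Suc n"] 2 3
    by (simp only: ring_distribs mult_ac) simp
qed

lemma theta_coeff_rec_0:
  "theta_coeff n 0 = (1 + q ^ (2 * n + 2)) * theta_coeff (Suc n) 0 - q ^ Suc n * (theta_coeff (Suc n) 1 + theta_coeff (Suc n) 1)"
proof -
  have "theta_coeff n 0 = phi n 1" "theta_coeff (Suc n) 0 = phi (Suc n) 1"
    "theta_coeff (Suc n) 1 = - (q ^ (n + 2) * phi (Suc n) q)"
    by (simp_all add: theta_coeff_def numeral_eq_Suc)
  moreover have "phi n 1 = (1 + q ^ (2 * n + 2)) * phi (Suc n) 1 + 2 * q ^ (2 * n + 3) * phi (Suc n) q"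
    using phi_rec[of n 1] phi_inverse_q[of "Suc n"] by (simp add: numeral_eq_Suc)
  moreover have "q ^ Suc n * q ^ (n + 2) = q ^ (2 * n + 3)"
    by (simp add: numeral_eq_Suc flip: power_add power_Suc)
  ultimately show ?thesis
    by (simp add: ring_distribs flip: mult.assoc)
qed

lemma theta_coeff_rec_int:
  "theta_coeff n (nat \<bar>M\<bar>) = (1 + q ^ (2 * n + 2)) * theta_coeff (Suc n) (nat \<bar>M\<bar>) -
    q ^ Suc n * (theta_coeff (Suc n) (nat \<bar>M - 1\<bar>) + theta_coeff (Suc n) (nat \<bar>M + 1\<bar>))"
proof (cases "nat \<bar>M\<bar>")
  case 0
  thus ?thesis using theta_coeff_rec_0[of n] by simp
next
  case (Suc p)
  hence "M = int (Suc p) \<or> M = - int (Suc p)" by auto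
  thus ?thesis
  proof
    assume "M = int (Suc p)"
    hence "nat \<bar>M - 1\<bar> = p" "nat \<bar>M + 1\<bar> = Suc (Suc p)" by auto
    thus ?thesis unfolding Suc by (simp only: theta_coeff_rec_Suc[of n p])
  next
    assume "M = - int (Suc p)"
    hence "nat \<bar>M - 1\<bar> = Suc (Suc p)" "nat \<bar>M + 1\<bar> = p" by auto
    thus ?thesis unfolding Suc by (simp only: theta_coeff_rec_Suc[of n p] add.commute[of "theta_coeff (Suc n) p"])
  qed
qed

lemma theta_coeff_bound:
  obtains D where "D \<ge> 0" "\<And>n N. norm (theta_coeff n N) \<le> D * norm q ^ triangle N * norm q ^ (n * N)"
proof -
  obtain C where C: "C \<ge> 0" "\<And>n y. norm y \<le> 1 \<Longrightarrow> norm (phi n y) \<le> C"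
    using phi_bound by blast
  have "norm (theta_coeff n N) \<le> C * norm q ^ triangle N * norm q ^ (n * N)" for n N
  proof -
    have "norm (q ^ N) \<le> 1"
      using norm_q by (simp add: norm_power power_le_one)
    from C(2)[OF this, of n] have "norm (phi n (q ^ N)) * norm q ^ (triangle N + n * N) \<le> C * norm q ^ (triangle N + n * N)"
      by (rule mult_right_mono) simp
    thus ?thesis by (simp add: theta_coeff_def norm_mult norm_power power_add mult_ac)
  qed
  with C(1) show ?thesis by (rule that)
qed

definition theta :: "nat \<Rightarrow> complex \<Rightarrow> complex"
  where "theta n a = (\<Sum>\<^sub>\<infinity>M. a powi M * theta_coeff n (nat \<bar>M\<bar>))"

lemma theta_has_sum: "((\<lambda>M. a powi M * theta_coeff n (nat \<bar>M\<bar>)) has_sum theta n a) UNIV"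
proof -
  obtain D where D: "D \<ge> 0" "\<And>n N. norm (theta_coeff n N) \<le> D * norm q ^ triangle N * norm q ^ (n * N)"
    using theta_coeff_bound by blast
  have "(\<lambda>M. a powi M * theta_coeff n (nat \<bar>M\<bar>)) summable_on UNIV"
  proof (rule summable_on_norm_bound)
    show "(\<lambda>M. D * (norm a powi M * norm q ^ triangle (nat \<bar>M\<bar>))) summable_on UNIV"
      using norm_q by (intro summable_on_cmult_right summable_on_powi_times_triangle) auto
    fix M :: int
    have "norm (theta_coeff n (nat \<bar>M\<bar>)) \<le> D * norm q ^ triangle (nat \<bar>M\<bar>) * norm q ^ (n * nat \<bar>M\<bar>)"
      by (rule D(2))
    also have "\<dots> \<le> D * norm q ^ triangle (nat \<bar>M\<bar>) * 1"
      using norm_q D(1) by (intro mult_left_mono power_le_one mult_nonneg_nonneg) auto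
    finally have "norm a powi M * norm (theta_coeff n (nat \<bar>M\<bar>)) \<le> norm a powi M * (D * norm q ^ triangle (nat \<bar>M\<bar>))"
      by (intro mult_left_mono) auto
    thus "norm (a powi M * theta_coeff n (nat \<bar>M\<bar>)) \<le> D * (norm a powi M * norm q ^ triangle (nat \<bar>M\<bar>))"
      by (simp add: norm_mult norm_power_int mult_ac)
  qed
  thus ?thesis unfolding theta_def by simp
qed

lemma has_sum_int_shift:
  fixes f :: "int \<Rightarrow> complex"
  assumes "(f has_sum S) UNIV"
  shows "((\<lambda>M. f (M + c)) has_sum S) UNIV"
proof -
  have "bij_betw (\<lambda>M. M + c) UNIV (UNIV :: int set)"
    by (rule bij_betwI[of _ _ _ "\<lambda>M. M - c"]) auto
  thus ?thesis using assms has_sum_reindex_bij_betw by blast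
qed

text \<open>The recurrence \<open>theta_coeff_rec_int\<close> compares coefficients of a^M after
  expanding (1 - a x)(1 - x/a) = 1 + x^2 - x (a + 1/a) with x = q^(n+1).\<close>

lemma theta_rec:
  assumes "a \<noteq> 0"
  shows "theta n a = (1 - a * q ^ Suc n) * (1 - q ^ Suc n / a) * theta (Suc n) a"
proof -
  let ?h = "\<lambda>M. a powi M * theta_coeff (Suc n) (nat \<bar>M\<bar>)"
  let ?S = "theta (Suc n) a"
  have 0: "(?h has_sum ?S) UNIV" by (rule theta_has_sum)
  have 1: "((\<lambda>M. a * ?h (M + (- 1))) has_sum a * ?S) UNIV"
    by (intro has_sum_cmult_right has_sum_int_shift 0)
  have 2: "((\<lambda>M. 1 / a * ?h (M + 1)) has_sum 1 / a * ?S) UNIV"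
    by (intro has_sum_cmult_right has_sum_int_shift 0)
  have "((\<lambda>M. (1 + q ^ (2 * n + 2)) * ?h M + (- (q ^ Suc n)) * (a * ?h (M + (- 1)) + 1 / a * ?h (M + 1))) has_sum
      (1 + q ^ (2 * n + 2)) * ?S + (- (q ^ Suc n)) * (a * ?S + 1 / a * ?S)) UNIV"
    by (intro has_sum_add has_sum_cmult_right 0 1 2)
  also have "(\<lambda>M. (1 + q ^ (2 * n + 2)) * ?h M + (- (q ^ Suc n)) * (a * ?h (M + (- 1)) + 1 / a * ?h (M + 1))) =
      (\<lambda>M. a powi M * theta_coeff n (nat \<bar>M\<bar>))"
  proof
    fix M :: int
    have "a * a powi (M + (- 1)) = a powi M" "1 / a * a powi (M + 1) = a powi M"
      using assms by (simp_all add: power_int_add power_int_diff)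
    hence p: "a * ?h (M + (- 1)) = a powi M * theta_coeff (Suc n) (nat \<bar>M - 1\<bar>)"
      "1 / a * ?h (M + 1) = a powi M * theta_coeff (Suc n) (nat \<bar>M + 1\<bar>)"
      by (simp_all only: mult.assoc [symmetric]) simp
    show "(1 + q ^ (2 * n + 2)) * ?h M + (- (q ^ Suc n)) * (a * ?h (M + (- 1)) + 1 / a * ?h (M + 1)) =
        a powi M * theta_coeff n (nat \<bar>M\<bar>)"
      unfolding p theta_coeff_rec_int[of n M] by (simp only: ring_distribs mult_ac) simp
  qed
  finally have "theta n a = (1 + q ^ (2 * n + 2)) * ?S + (- (q ^ Suc n)) * (a * ?S + 1 / a * ?S)"
    using theta_has_sum has_sum_unique by blast
  moreover have "q ^ (2 * n + 2) = q ^ Suc n * q ^ Suc n"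
    by (simp add: numeral_eq_Suc flip: power_add power_Suc)
  moreover have "(1 + x * x) * S + (- x) * (a * S + 1 / a * S) = (1 - a * x) * (1 - x / a) * S" for x S
    using assms by (simp add: field_simps)
  ultimately show ?thesis by (simp only:)
qed

text \<open>The term M = 0 of \<open>theta n a\<close> is \<open>phi n 1\<close>, and every other
  term carries at least a factor q^n.\<close>

lemma norm_theta_minus_phi_le:
  obtains K where "\<And>n. norm (theta n a - phi n 1) \<le> norm q ^ n * K"
proof -
  obtain D where D: "D \<ge> 0" "\<And>n N. norm (theta_coeff n N) \<le> D * norm q ^ triangle N * norm q ^ (n * N)"
    using theta_coeff_bound by blast
  define g where "g = (\<lambda>M::int. D * (norm a powi M * norm q ^ triangle (nat \<bar>M\<bar>)))"
  have g: "(g has_sum infsum g UNIV) UNIV"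
    unfolding g_def using norm_q by (intro has_sum_infsum summable_on_cmult_right summable_on_powi_times_triangle) auto
  have "norm (theta n a - phi n 1) \<le> norm q ^ n * infsum g UNIV" for n
  proof -
    define f where "f = (\<lambda>M. a powi M * theta_coeff n (nat \<bar>M\<bar>) + (if M = 0 then - phi n 1 else 0))"
    have "((\<lambda>M::int. if M = 0 then - phi n 1 else 0) has_sum - phi n 1) UNIV"
      by (rule has_sum_finite_neutralI[of "{0}"]) auto
    from has_sum_add[OF theta_has_sum[of a n] this]
    have f: "(f has_sum (theta n a - phi n 1)) UNIV"
      by (simp only: f_def diff_conv_add_uminus)
    have "norm (f M) \<le> norm q ^ n * g M" for M
    proof (cases "M = 0")
      case True
      thus ?thesis using D(1) by (simp add: f_def theta_coeff_def g_def)
    next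
      case False
      have "norm (theta_coeff n (nat \<bar>M\<bar>)) \<le> D * norm q ^ triangle (nat \<bar>M\<bar>) * norm q ^ (n * nat \<bar>M\<bar>)"
        by (rule D(2))
      also have "\<dots> \<le> D * norm q ^ triangle (nat \<bar>M\<bar>) * norm q ^ n"
        using norm_q D(1) False by (intro mult_left_mono power_decreasing mult_nonneg_nonneg) auto
      finally have "norm a powi M * norm (theta_coeff n (nat \<bar>M\<bar>)) \<le> norm a powi M * (D * norm q ^ triangle (nat \<bar>M\<bar>) * norm q ^ n)"
        by (intro mult_left_mono) auto
      thus ?thesis using False
        by (simp add: f_def norm_mult norm_power_int g_def mult_ac)
    qed
    from norm_infsum_le[OF f has_sum_cmult_right[OF g] this] show ?thesis by blast
  qed
  thus ?thesis by (rule that)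
qed

lemma theta_tendsto: "(\<lambda>n. theta n a) \<longlonglongrightarrow> qfac_inf"
proof -
  obtain K where K: "\<And>n. norm (theta n a - phi n 1) \<le> norm q ^ n * K"
    by (rule norm_theta_minus_phi_le[of a]) blast
  have "(\<lambda>n. norm q ^ n) \<longlonglongrightarrow> 0"
    using norm_q by (intro LIMSEQ_power_zero) simp
  from tendsto_mult_left_zero[OF this] have "(\<lambda>n. norm q ^ n * K) \<longlonglongrightarrow> 0" .
  hence "(\<lambda>n. theta n a - phi n 1) \<longlonglongrightarrow> 0"
    by (rule Lim_null_comparison[rotated]) (simp add: K)
  from this phi_1_tendsto have "(\<lambda>n. theta n a - phi n 1 + phi n 1) \<longlonglongrightarrow> 0 + qfac_inf"
    by (rule tendsto_add)
  thus ?thesis by (simp only: diff_add_cancel add_0_left)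
qed

lemma qpoch_inf_LIMSEQ: "(\<lambda>m. \<Prod>j<m. 1 - x * q ^ j) \<longlonglongrightarrow> qpoch_inf x q"
proof -
  have "(\<lambda>n. \<Prod>j\<le>n. 1 - x * q ^ j) \<longlonglongrightarrow> qpoch_inf x q"
    unfolding qpoch_inf_def by (rule convergent_prod_LIMSEQ[OF convergent_prod_qpoch[OF norm_q]])
  hence "(\<lambda>n. \<Prod>j<Suc n. 1 - x * q ^ j) \<longlonglongrightarrow> qpoch_inf x q"
    by (simp only: lessThan_Suc_atMost)
  thus ?thesis by (rule LIMSEQ_imp_Suc)
qed

text \<open>Split off m pairs of factors with \<open>theta_rec\<close> and let m grow: the finite
  products converge to infinite ones and the remaining \<open>theta (m + n) a\<close> tends to
  (q;q)_\<infinity>.\<close>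

theorem theta_eq:
  assumes "a \<noteq> 0"
  shows "theta n a = qpoch_inf (a * q ^ Suc n) q * qpoch_inf (q ^ Suc n / a) q * qfac_inf"
proof (rule LIMSEQ_unique)
  have "theta n a = (\<Prod>j<m. 1 - a * q ^ Suc n * q ^ j) * (\<Prod>j<m. 1 - q ^ Suc n / a * q ^ j) * theta (m + n) a" for m
  proof (induction m)
    case (Suc m)
    have "theta (m + n) a = (1 - a * q ^ Suc (m + n)) * (1 - q ^ Suc (m + n) / a) * theta (Suc m + n) a"
      using theta_rec[OF assms, of "m + n"] by simp
    also have "q ^ Suc (m + n) = q ^ Suc n * q ^ m"
      by (simp add: power_add mult_ac)
    finally have e: "theta (m + n) a = (1 - a * q ^ Suc n * q ^ m) * (1 - q ^ Suc n / a * q ^ m) * theta (Suc m + n) a"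
      by (simp only: mult.assoc times_divide_eq_left)
    show ?case
      by (subst Suc.IH) (simp only: e prod.lessThan_Suc mult_ac)
  qed simp
  hence "(\<lambda>m. (\<Prod>j<m. 1 - a * q ^ Suc n * q ^ j) * (\<Prod>j<m. 1 - q ^ Suc n / a * q ^ j) * theta (m + n) a) = (\<lambda>_. theta n a)"
    by (rule ext [OF sym])
  thus "(\<lambda>m. (\<Prod>j<m. 1 - a * q ^ Suc n * q ^ j) * (\<Prod>j<m. 1 - q ^ Suc n / a * q ^ j) * theta (m + n) a) \<longlonglongrightarrow> theta n a"
    by (simp only: tendsto_const)
  show "(\<lambda>m. (\<Prod>j<m. 1 - a * q ^ Suc n * q ^ j) * (\<Prod>j<m. 1 - q ^ Suc n / a * q ^ j) * theta (m + n) a) \<longlonglongrightarrow>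
      qpoch_inf (a * q ^ Suc n) q * qpoch_inf (q ^ Suc n / a) q * qfac_inf"
    by (rule tendsto_mult[OF tendsto_mult[OF qpoch_inf_LIMSEQ qpoch_inf_LIMSEQ] LIMSEQ_ignore_initial_segment[OF theta_tendsto]])
qed

end

section \<open>The Jacobi triple product\<close>

text \<open>M(M-1) is even and nonnegative for every integer M, so neither \<open>div\<close> nor
  \<open>nat\<close> loses anything.\<close>

definition int_choose2 :: "int \<Rightarrow> nat"
  where "int_choose2 M = nat (M * (M - 1) div 2)"

lemma two_times_int_choose2: "2 * int (int_choose2 M) = M * (M - 1)"
proof -
  have "M * (M - 1) \<ge> 0"
    by (cases "M \<ge> 1") (auto simp: zero_le_mult_iff)
  moreover have "even (M * (M - 1))" by simp
  ultimately show ?thesis by (simp add: int_choose2_def)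
qed

lemma two_times_triangle: "2 * triangle n = n * Suc n"
  by (induction n) simp_all

lemma int_choose2_eqI: "M * (M - 1) = 2 * int m \<Longrightarrow> int_choose2 M = m"
  using two_times_int_choose2[of M] by simp

lemma int_choose2_minus [simp]: "int_choose2 (- int n) = triangle n"
  by (rule int_choose2_eqI) (use two_times_triangle[of n, THEN arg_cong[of _ _ int]] in \<open>simp add: algebra_simps\<close>)

lemma int_choose2_Suc: "int_choose2 (int (Suc n)) = triangle n"
  by (rule int_choose2_eqI) (use two_times_triangle[of n, THEN arg_cong[of _ _ int]] in \<open>simp add: algebra_simps\<close>)

lemma triangle_eq_choose: "triangle n = Suc n choose 2"
  by (induction n) (simp_all add: numeral_2_eq_2)

context qseries
begin

lemma qpoch_inf_rec: "qpoch_inf a q = (1 - a) * qpoch_inf (a * q) q"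
proof (rule LIMSEQ_unique)
  show "(\<lambda>m. \<Prod>j<Suc m. 1 - a * q ^ j) \<longlonglongrightarrow> qpoch_inf a q"
    by (rule LIMSEQ_Suc[OF qpoch_inf_LIMSEQ])
  have "(\<lambda>m. (1 - a) * (\<Prod>j<m. 1 - a * q * q ^ j)) \<longlonglongrightarrow> (1 - a) * qpoch_inf (a * q) q"
    by (rule tendsto_mult[OF tendsto_const qpoch_inf_LIMSEQ])
  thus "(\<lambda>m. \<Prod>j<Suc m. 1 - a * q ^ j) \<longlonglongrightarrow> (1 - a) * qpoch_inf (a * q) q"
    by (simp add: prod.lessThan_Suc_shift mult_ac del: prod.lessThan_Suc)
qed

text \<open>For n = 0 the q-factorials in \<open>phi_coeff\<close> cancel and \<open>phi 0\<close>
  satisfies phi(y) = 1 - q y phi(q y). Hence \<open>theta_coeff 0 N\<close> is the tail, from index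
  N on, of the alternating series of q^(m(m+1)/2).\<close>

lemma theta_coeff_0_diff: "theta_coeff 0 N - theta_coeff 0 (Suc N) = (- 1) ^ N * q ^ triangle N"
proof -
  have c: "phi_coeff 0 m = (- 1) ^ m * q ^ triangle m" for m
    by (simp add: phi_coeff_def)
  have "(\<lambda>m. - (q ^ Suc N) * (phi_coeff 0 m * (q ^ Suc N) ^ m)) sums (- (q ^ Suc N) * phi 0 (q ^ Suc N))"
    by (rule sums_mult[OF phi_sums])
  also have "(\<lambda>m. - (q ^ Suc N) * (phi_coeff 0 m * (q ^ Suc N) ^ m)) = (\<lambda>m. phi_coeff 0 (Suc m) * (q ^ N) ^ Suc m)"
    by (simp add: c fun_eq_iff power_add power_mult_distrib mult_ac)
  finally have "(\<lambda>m. phi_coeff 0 m * (q ^ N) ^ m) sums (- (q ^ Suc N) * phi 0 (q ^ Suc N) + phi_coeff 0 0 * (q ^ N) ^ 0)"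
    by (rule sums_Suc_iff[of "\<lambda>m. phi_coeff 0 m * (q ^ N) ^ m", THEN iffD1])
  hence "phi 0 (q ^ N) = - (q ^ Suc N) * phi 0 (q ^ Suc N) + phi_coeff 0 0 * (q ^ N) ^ 0"
    by (rule sums_unique2[OF phi_sums])
  hence "phi 0 (q ^ N) = 1 - q ^ Suc N * phi 0 (q ^ Suc N)"
    by (simp add: phi_coeff_0)
  thus ?thesis
    unfolding theta_coeff_def by (simp only:) (simp add: power_add ring_distribs mult_ac)
qed

text \<open>Multiply the expansion of \<open>theta 0 a\<close> by 1 - a. On the product side this
  supplies the missing factor of (a;q)_\<infinity>; on the series side it takes differences of
  neighbouring coefficients, which are single monomials.\<close>

theorem jacobi_triple_product:
  assumes "a \<noteq> 0"
  shows "((\<lambda>M. (- 1) powi M * q ^ int_choose2 M * a powi M) has_sum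
    (qfac_inf * qpoch_inf a q * qpoch_inf (q / a) q)) UNIV"
proof -
  let ?G = "\<lambda>M::int. theta_coeff 0 (nat \<bar>M\<bar>)"
  let ?h = "\<lambda>M. a powi M * ?G M"
  have "((\<lambda>M. ?h M + (- a) * ?h (M + (- 1))) has_sum (theta 0 a + (- a) * theta 0 a)) UNIV"
    by (intro has_sum_add has_sum_cmult_right has_sum_int_shift theta_has_sum)
  also have "(\<lambda>M. ?h M + (- a) * ?h (M + (- 1))) = (\<lambda>M. (- 1) powi M * q ^ int_choose2 M * a powi M)"
  proof
    fix M :: int
    have "a * a powi (M + (- 1)) = a powi M"
      using assms by (simp add: power_int_diff)
    hence "?h M + (- a) * ?h (M + (- 1)) = a powi M * (?G M - ?G (M - 1))"
      by (simp add: ring_distribs flip: mult.assoc)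
    also have "?G M - ?G (M - 1) = (- 1) powi M * q ^ int_choose2 M"
    \<comment> \<open>The coefficients depend on |M|, which exceeds |M - 1| exactly when M >= 1. So
      \<open>theta_coeff_0_diff\<close> enters with N = M - 1 and reversed sign, or with N =
      -M.\<close>
    proof (cases "M \<ge> 1")
      case True
      define N where "N = nat (M - 1)"
      have M: "M = int (Suc N)" using True by (simp add: N_def)
      have "nat \<bar>M\<bar> = Suc N" "nat \<bar>M - 1\<bar> = N" by (simp_all add: M)
      moreover have "(- 1 :: complex) powi M = - ((- 1) ^ N)"
        unfolding M power_int_of_nat by simp
      moreover have "int_choose2 M = triangle N"
        unfolding M by (rule int_choose2_Suc)
      ultimately show ?thesis
        using theta_coeff_0_diff[of N] by (simp only:) (simp add: algebra_simps)
    next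
      case False
      define N where "N = nat (- M)"
      have M: "M = - int N" using False by (simp add: N_def)
      have "nat \<bar>M\<bar> = N" "nat \<bar>M - 1\<bar> = Suc N" by (simp_all add: M)
      moreover have "(- 1 :: complex) powi M = (- 1) ^ N"
        by (simp add: M power_int_minus flip: power_inverse)
      moreover have "int_choose2 M = triangle N"
        unfolding M by (rule int_choose2_minus)
      ultimately show ?thesis
        using theta_coeff_0_diff[of N] by (simp only:)
    qed
    finally show "?h M + (- a) * ?h (M + (- 1)) = (- 1) powi M * q ^ int_choose2 M * a powi M"
      by (simp only: mult_ac)
  qed
  also have "theta 0 a + (- a) * theta 0 a = qfac_inf * qpoch_inf a q * qpoch_inf (q / a) q"
    unfolding theta_eq[OF assms] qpoch_inf_rec[of a] by (simp add: algebra_simps)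
  finally show ?thesis .
qed

section \<open>Coefficients of the left-hand side\<close>

lemma bailey_beta_bound:
  obtains C where "C \<ge> 0" "\<And>n. norm (bailey_beta K n) \<le> C"
proof -
  obtain C where C: "C \<ge> 1" "\<And>n. norm (qfac n) \<le> C" "\<And>n. norm (1 / qfac n) \<le> C"
    using qfac_bounds by blast
  have "norm (bailey_beta K n) \<le> 2 * (C * C) * (1 / (1 - norm q))" for n
  proof -
    have "norm (bailey_beta K n) \<le> (\<Sum>r\<le>n. 2 * (C * C) * norm q ^ r)"
      unfolding bailey_beta_def
    proof (rule sum_norm_le)
      fix r
      have "norm (1 - q ^ (2 * r + 1)) \<le> norm (1 :: complex) + norm (q ^ (2 * r + 1))"
        by (rule norm_triangle_ineq4)
      also have "norm (q ^ (2 * r + 1)) \<le> 1"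
        unfolding norm_power using norm_q by (intro power_le_one) auto
      finally have 1: "norm (1 - q ^ (2 * r + 1)) \<le> 2" by simp
      have "r \<le> K * (r\<^sup>2 + r) + r\<^sup>2"
        using self_le_power[of r 2] by (cases r) (auto intro: trans_le_add2)
      hence 2: "norm q ^ (K * (r\<^sup>2 + r) + r\<^sup>2) \<le> norm q ^ r"
        using norm_q by (intro power_decreasing) auto
      have "norm ((- 1) ^ r * q ^ (K * (r\<^sup>2 + r) + r\<^sup>2) * (1 - q ^ (2 * r + 1)) / (qfac (n - r) * qfac (n + r + 1))) =
          norm q ^ (K * (r\<^sup>2 + r) + r\<^sup>2) * norm (1 - q ^ (2 * r + 1)) * (norm (1 / qfac (n - r)) * norm (1 / qfac (n + r + 1)))"
        by (simp only: norm_mult norm_divide norm_power) simp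
      also have "\<dots> \<le> norm q ^ r * 2 * (C * C)"
        using C(1) by (intro mult_mono 1 2 C mult_nonneg_nonneg) auto
      finally show "norm ((- 1) ^ r * q ^ (K * (r\<^sup>2 + r) + r\<^sup>2) * (1 - q ^ (2 * r + 1)) / (qfac (n - r) * qfac (n + r + 1))) \<le>
          2 * (C * C) * norm q ^ r"
        by (simp only: mult_ac)
    qed
    also have "\<dots> = 2 * (C * C) * (\<Sum>r\<le>n. norm q ^ r)"
      by (simp add: sum_distrib_left)
    also have "(\<Sum>r\<le>n. norm q ^ r) \<le> 1 / (1 - norm q)"
    proof -
      have "(\<Sum>r\<in>{..n}. norm q ^ r) \<le> suminf (\<lambda>r. norm q ^ r)"
        using norm_q by (intro sum_le_suminf summable_geometric) auto
      thus ?thesis using norm_q by (simp add: suminf_geometric)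
    qed
    finally show ?thesis using C(1) by simp
  qed
  moreover have "2 * (C * C) * (1 / (1 - norm q)) \<ge> 0"
    using C(1) norm_q by simp
  ultimately show ?thesis using that by blast
qed

text \<open>
  \<open>bailey_theta K N n\<close> is the contribution of the \<open>n\<close>-th term of the left-hand side to the coefficient of
  \<open>a\<^bsup>\<plusminus>N\<^esup>\<close>, after multiplication by \<open>(q, a, q/a; q)\<^sub>\<infinity>\<close>.
\<close>

definition bailey_theta :: "nat \<Rightarrow> nat \<Rightarrow> nat \<Rightarrow> complex"
  where "bailey_theta K N n = qfac (2 * n) * q ^ n * bailey_beta K n * theta_coeff n N"

text \<open>The coefficient of a^M, with N = |M|, on the left-hand side after multiplication by (q,
  a, q/a; q)_\<infinity>. Only s >= 0 occurs, which makes it a partial theta function.\<close>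

definition partial_theta :: "nat \<Rightarrow> nat \<Rightarrow> complex"
  where "partial_theta k N = (- 1) ^ N * q ^ triangle N * (\<Sum>\<^sub>\<infinity>s. (- 1) ^ s * q ^ (k * (s\<^sup>2 + s) + s * N))"

lemma bailey_theta_bound:
  obtains C where "C \<ge> 0" "\<And>n N. norm (bailey_theta K N n) \<le> C * norm q ^ n * norm q ^ triangle N"
proof -
  obtain B where B: "B \<ge> 0" "\<And>n. norm (bailey_beta K n) \<le> B"
    using bailey_beta_bound by blast
  obtain D where D: "D \<ge> 0" "\<And>n N. norm (theta_coeff n N) \<le> D * norm q ^ triangle N * norm q ^ (n * N)"
    using theta_coeff_bound by blast
  obtain C where C: "C \<ge> 1" "\<And>n. norm (qfac n) \<le> C" "\<And>n. norm (1 / qfac n) \<le> C"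
    using qfac_bounds by blast
  have "norm (bailey_theta K N n) \<le> (C * B * D) * norm q ^ n * norm q ^ triangle N" for n N
  proof -
    have "norm (theta_coeff n N) \<le> D * norm q ^ triangle N * norm q ^ (n * N)"
      by (rule D(2))
    also have "\<dots> \<le> D * norm q ^ triangle N * 1"
      using D(1) norm_q by (intro mult_left_mono power_le_one mult_nonneg_nonneg) auto
    finally have 1: "norm (theta_coeff n N) \<le> D * norm q ^ triangle N" by simp
    have "norm (bailey_theta K N n) = norm (qfac (2 * n)) * norm q ^ n * norm (bailey_beta K n) * norm (theta_coeff n N)"
      by (simp add: bailey_theta_def norm_mult norm_power)
    also have "\<dots> \<le> C * norm q ^ n * B * (D * norm q ^ triangle N)"
      using B(1) C(1) D(1) by (intro mult_mono 1 B C mult_nonneg_nonneg) auto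
    finally show ?thesis by (simp only: mult_ac)
  qed
  moreover have "C * B * D \<ge> 0" using B(1) C(1) D(1) by simp
  ultimately show ?thesis using that by blast
qed

text \<open>Expanding \<open>phi\<close> inside \<open>theta_coeff\<close> gives an absolutely
  convergent double series in n and m. Its rows are the \<open>bailey_theta K N n\<close>, and its
  antidiagonals n + m = s are evaluated by \<open>bailey_inversion\<close>.\<close>

lemma bailey_theta_has_sum: "(bailey_theta K N has_sum partial_theta (Suc K) N) UNIV"
proof -
  define X where "X = (\<lambda>n m. (- 1) ^ m * q ^ (triangle m + n + (n + m) * N) * qfac (2 * n + m) / qfac m * bailey_beta K n)"
  define w where "w = (- 1) ^ N * q ^ triangle N"
  obtain B where B: "B \<ge> 0" "\<And>n. norm (bailey_beta K n) \<le> B"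
    using bailey_beta_bound by blast
  obtain C where C: "C \<ge> 1" "\<And>n. norm (qfac n) \<le> C" "\<And>n. norm (1 / qfac n) \<le> C"
    using qfac_bounds by blast
  have X_bound: "norm (X n m) \<le> C * C * B * (norm q ^ n * norm q ^ triangle m)" for n m
  proof -
    have "norm (X n m) = norm q ^ (triangle m + n + (n + m) * N) * norm (qfac (2 * n + m)) * norm (1 / qfac m) * norm (bailey_beta K n)"
      by (simp add: X_def norm_mult norm_power norm_divide)
    also have "norm q ^ (triangle m + n + (n + m) * N) \<le> norm q ^ (triangle m + n)"
      using norm_q by (intro power_decreasing) auto
    hence "norm q ^ (triangle m + n + (n + m) * N) * norm (qfac (2 * n + m)) * norm (1 / qfac m) * norm (bailey_beta K n) \<le>
        norm q ^ (triangle m + n) * C * C * B"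
      using C(1) by (intro mult_mono B C mult_nonneg_nonneg) auto
    finally show ?thesis by (simp add: power_add mult_ac)
  qed
  have "(\<lambda>(n, m). norm q ^ n * norm q ^ triangle m) summable_on UNIV \<times> UNIV"
  proof (rule summable_on_mult_Times)
    show "(\<lambda>n. norm q ^ n) summable_on UNIV"
      using norm_q by (subst summable_on_UNIV_nonneg_real_iff) (auto intro: summable_geometric)
    show "(\<lambda>n. norm q ^ triangle n) summable_on UNIV"
      using summable_power_times_triangle[of 1 "norm q"] norm_q by (subst summable_on_UNIV_nonneg_real_iff) auto
  qed auto
  hence "(\<lambda>p. C * C * B * (case p of (n, m) \<Rightarrow> norm q ^ n * norm q ^ triangle m)) summable_on UNIV \<times> UNIV"
    by (rule summable_on_cmult_right)
  hence X_summable: "(\<lambda>(n, m). X n m) summable_on UNIV \<times> UNIV"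
    by (rule summable_on_norm_bound) (use X_bound in auto)
  then obtain S where S: "((\<lambda>(n, m). X n m) has_sum S) (UNIV \<times> UNIV)"
    by (auto simp: summable_on_def)
  have row: "((\<lambda>m. w * X n m) has_sum bailey_theta K N n) UNIV" for n
  proof -
    have "((\<lambda>m. phi_coeff n m * (q ^ N) ^ m) has_sum phi n (q ^ N)) UNIV"
      by (rule norm_summable_imp_has_sum[OF summable_norm_phi phi_sums])
    from has_sum_cmult_right[OF this, of "w * qfac (2 * n) * q ^ (n + n * N) * bailey_beta K n"]
    have "((\<lambda>m. w * qfac (2 * n) * q ^ (n + n * N) * bailey_beta K n * (phi_coeff n m * (q ^ N) ^ m)) has_sum
        w * qfac (2 * n) * q ^ (n + n * N) * bailey_beta K n * phi n (q ^ N)) UNIV" .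
    also have "(\<lambda>m. w * qfac (2 * n) * q ^ (n + n * N) * bailey_beta K n * (phi_coeff n m * (q ^ N) ^ m)) = (\<lambda>m. w * X n m)"
    proof
      fix m
      have "(q ^ N) ^ m = q ^ (m * N)"
        by (simp add: mult.commute flip: power_mult)
      thus "w * qfac (2 * n) * q ^ (n + n * N) * bailey_beta K n * (phi_coeff n m * (q ^ N) ^ m) = w * X n m"
        unfolding X_def phi_coeff_def by (simp add: power_add algebra_simps)
    qed
    also have "w * qfac (2 * n) * q ^ (n + n * N) * bailey_beta K n * phi n (q ^ N) = bailey_theta K N n"
      by (simp add: w_def bailey_theta_def theta_coeff_def power_add mult_ac)
    finally show ?thesis .
  qed
  have "((\<lambda>p. w * (case p of (n, m) \<Rightarrow> X n m)) has_sum w * S) (UNIV \<times> UNIV)"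
    by (rule has_sum_cmult_right[OF S])
  hence 1: "(bailey_theta K N has_sum w * S) UNIV"
    by (rule has_sum_Sigma') (use row in simp)
  \<comment> \<open>Regrouping by antidiagonals s = n + m, with n at most s, so that m = s - n is
    exact.\<close>
  have bij: "bij_betw (\<lambda>(s, n). (n, s - n)) (Sigma UNIV (\<lambda>s. {..s})) (UNIV \<times> (UNIV :: nat set))"
    by (rule bij_betwI[of _ _ _ "\<lambda>(n, m). (n + m, n)"]) auto
  have "((\<lambda>p. case (case p of (s, n) \<Rightarrow> (n, s - n)) of (n, m) \<Rightarrow> X n m) has_sum S) (Sigma UNIV (\<lambda>s. {..s}))"
    using has_sum_reindex_bij_betw[OF bij, of "\<lambda>(n, m). X n m" S] S by simp
  hence "((\<lambda>s. \<Sum>n\<le>s. X n (s - n)) has_sum S) UNIV"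
    by (rule has_sum_Sigma') (use has_sum_finite in auto)
  also have "(\<lambda>s. \<Sum>n\<le>s. X n (s - n)) = (\<lambda>s. (- 1) ^ s * q ^ (Suc K * (s\<^sup>2 + s) + s * N))"
  proof
    fix s
    have "(\<Sum>n\<le>s. X n (s - n)) = (\<Sum>n\<le>s. q ^ (s + s * N) *
        ((- 1) ^ (s - n) * q ^ ((s - n) choose 2) * qfac (s + n) / qfac (s - n) * bailey_beta K n))"
    proof (rule sum.cong)
      fix n assume "n \<in> {..s}"
      then obtain m where s: "s = n + m" using le_Suc_ex by auto
      \<comment> \<open>Moves q^m out of the triangular power, where it joins q^n to form q^s; what
        depends on n is then exactly the inversion kernel.\<close>
      have "triangle m = m + (m choose 2)"
        by (simp add: triangle_eq_choose numeral_2_eq_2)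
      hence "q ^ (triangle m + n + (n + m) * N) = q ^ (s + s * N) * q ^ (m choose 2)"
        unfolding power_add [symmetric] by (simp add: s add_ac)
      moreover have "s - n = m" "s + n = 2 * n + m" "n + m = s" by (simp_all add: s)
      ultimately show "X n (s - n) = q ^ (s + s * N) *
          ((- 1) ^ (s - n) * q ^ ((s - n) choose 2) * qfac (s + n) / qfac (s - n) * bailey_beta K n)"
        unfolding X_def by (simp only: times_divide_eq_right times_divide_eq_left mult_ac)
    qed simp
    also have "\<dots> = q ^ (s + s * N) * ((- 1) ^ s * q ^ (K * (s\<^sup>2 + s) + s\<^sup>2))"
      unfolding sum_distrib_left [symmetric] bailey_inversion ..
    also have "\<dots> = (- 1) ^ s * q ^ (Suc K * (s\<^sup>2 + s) + s * N)"
      by (simp add: power_add mult_ac)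
    finally show "(\<Sum>n\<le>s. X n (s - n)) = (- 1) ^ s * q ^ (Suc K * (s\<^sup>2 + s) + s * N)" .
  qed
  finally have "(\<Sum>\<^sub>\<infinity>s. (- 1) ^ s * q ^ (Suc K * (s\<^sup>2 + s) + s * N)) = S"
    by (rule infsumI)
  with 1 show ?thesis
    by (simp add: partial_theta_def w_def)
qed

text \<open>Both series are iterated sums of one absolutely convergent double series in n and M: by
  rows it is the Laurent expansion of \<open>theta n a\<close>, by columns
  \<open>bailey_theta_has_sum\<close>. Hence they share the value S.\<close>

lemma partial_theta_has_sum:
  assumes "a \<noteq> 0"
  shows "\<exists>S. ((\<lambda>n. qfac (2 * n) * q ^ n * bailey_beta K n * theta n a) has_sum S) UNIV \<and>
    ((\<lambda>M. a powi M * partial_theta (Suc K) (nat \<bar>M\<bar>)) has_sum S) UNIV"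
proof -
  let ?f = "\<lambda>n M. a powi M * bailey_theta K (nat \<bar>M\<bar>) n"
  obtain C where C: "C \<ge> 0" "\<And>n N. norm (bailey_theta K N n) \<le> C * norm q ^ n * norm q ^ triangle N"
    using bailey_theta_bound by blast
  have "(\<lambda>(n, M). norm q ^ n * (norm a powi M * norm q ^ triangle (nat \<bar>M\<bar>))) summable_on UNIV \<times> UNIV"
  proof (rule summable_on_mult_Times)
    show "(\<lambda>n. norm q ^ n) summable_on UNIV"
      using norm_q by (subst summable_on_UNIV_nonneg_real_iff) (auto intro: summable_geometric)
    show "(\<lambda>M. norm a powi M * norm q ^ triangle (nat \<bar>M\<bar>)) summable_on UNIV"
      using norm_q by (intro summable_on_powi_times_triangle) auto
  qed auto
  hence "(\<lambda>p. C * (case p of (n, M) \<Rightarrow> norm q ^ n * (norm a powi M * norm q ^ triangle (nat \<bar>M\<bar>)))) summable_on UNIV \<times> UNIV"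
    by (rule summable_on_cmult_right)
  hence "(\<lambda>(n, M). ?f n M) summable_on UNIV \<times> UNIV"
  proof (rule summable_on_norm_bound)
    fix p :: "nat \<times> int"
    obtain n M where p: "p = (n, M)" by force
    have "norm a powi M * norm (bailey_theta K (nat \<bar>M\<bar>) n) \<le> norm a powi M * (C * norm q ^ n * norm q ^ triangle (nat \<bar>M\<bar>))"
      by (intro mult_left_mono C) auto
    thus "norm (case p of (n, M) \<Rightarrow> ?f n M) \<le> C * (case p of (n, M) \<Rightarrow> norm q ^ n * (norm a powi M * norm q ^ triangle (nat \<bar>M\<bar>)))"
      by (simp add: p norm_mult norm_power_int mult_ac)
  qed
  then obtain S where S: "((\<lambda>(n, M). ?f n M) has_sum S) (UNIV \<times> UNIV)"
    by (auto simp: summable_on_def)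
  have row: "((\<lambda>M. ?f n M) has_sum qfac (2 * n) * q ^ n * bailey_beta K n * theta n a) UNIV" for n
    using has_sum_cmult_right[OF theta_has_sum[of a n], of "qfac (2 * n) * q ^ n * bailey_beta K n"]
    unfolding bailey_theta_def by (simp only: mult_ac)
  have 1: "((\<lambda>n. qfac (2 * n) * q ^ n * bailey_beta K n * theta n a) has_sum S) UNIV"
    using S by (rule has_sum_Sigma') (use row in simp)
  have "((\<lambda>(M, n). ?f n M) has_sum S) (UNIV \<times> UNIV)"
    using has_sum_swap[THEN iffD1, OF S] by simp
  hence "((\<lambda>M. a powi M * partial_theta (Suc K) (nat \<bar>M\<bar>)) has_sum S) UNIV"
  proof (rule has_sum_Sigma')
    fix M :: int
    have "((\<lambda>n. ?f n M) has_sum a powi M * partial_theta (Suc K) (nat \<bar>M\<bar>)) UNIV"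
      by (rule has_sum_cmult_right[OF bailey_theta_has_sum])
    thus "((\<lambda>n. case (M, n) of (M, n) \<Rightarrow> ?f n M) has_sum a powi M * partial_theta (Suc K) (nat \<bar>M\<bar>)) UNIV"
      by simp
  qed
  with 1 show ?thesis by blast
qed

end

section \<open>Coefficients of the right-hand side\<close>

lemma triangle_le_square: "triangle n \<le> n * n"
  by (induction n) simp_all

lemma triangle_add: "triangle (m + n) = triangle m + triangle n + m * n"
  by (induction n) simp_all

text \<open>Matches the exponents of \<open>theta_term\<close> with those of
  \<open>partial_theta\<close>; the point is that 2k triangular numbers of index s add up to k(s^2 +
  s).\<close>

lemma theta_exponent_eq:
  assumes "k \<ge> 1"
  shows "triangle (N + s) + (2 * k - 1) * triangle s = triangle N + (k * (s\<^sup>2 + s) + s * N)"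
proof -
  have "triangle s + (2 * k - 1) * triangle s = Suc (2 * k - 1) * triangle s"
    by simp
  also have "\<dots> = 2 * k * triangle s"
    using assms by simp
  also have "\<dots> = k * (s\<^sup>2 + s)"
    using two_times_triangle[of s] by (simp add: power2_eq_square algebra_simps)
  finally show ?thesis
    by (simp add: triangle_add mult.commute)
qed

lemma minus_one_powi_even: "(- 1 :: complex) powi (2 * m) = 1"
  by (simp add: power_int_mult)

lemma powi_int_mult: "(x :: complex) powi (int n * m) = (x ^ n) powi m"
  by (simp add: power_int_mult)

context qseries
begin

text \<open>
  The coefficient of \<open>a\<^sup>M\<close> in \<open>(q, a, q/a; q)\<^sub>\<infinity> \<Sum>\<^sub>n a\<^sup>n q\<^bsup>(2k-1)n(n+1)/2\<^esup>\<close> is the sum of \<open>theta_term k M u\<close>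
  over \<open>u = -n \<le> 0\<close>. Letting \<open>u\<close> range over all integers completes it to a product.
\<close>

definition theta_term :: "nat \<Rightarrow> int \<Rightarrow> int \<Rightarrow> complex"
  where "theta_term k M u = (- 1) powi (M + u) * q ^ (int_choose2 (M + u) + (2 * k - 1) * int_choose2 u)"

text \<open>The product (q^i, q^(2k-i), q^(2k); q^(2k))_\<infinity>, written as the triple product
  in base q^(2k) at the point q^i. The quotient in the last factor has a meaning for every
  i.\<close>

definition theta_product :: "nat \<Rightarrow> nat \<Rightarrow> complex"
  where "theta_product k i = qpoch_inf (q ^ (2 * k)) (q ^ (2 * k)) * qpoch_inf (q ^ i) (q ^ (2 * k)) *
    qpoch_inf (q ^ (2 * k) / q ^ i) (q ^ (2 * k))"

lemma qseries_power:
  assumes "m \<ge> 1"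
  shows "qseries (q ^ m)"
  using assms norm_q q_nonzero by unfold_locales (auto simp: norm_power power_less_one_iff)

text \<open>The factor (1; q^(2k))_\<infinity> contains 1 - 1. This removes the residue class i = 0
  modulo 2k.\<close>

lemma theta_product_0:
  assumes "k \<ge> 1"
  shows "theta_product k 0 = 0"
proof -
  interpret p: qseries "q ^ (2 * k)"
    using assms by (intro qseries_power) simp
  have "qpoch_inf 1 (q ^ (2 * k)) = 0"
    using p.qpoch_inf_rec[of 1] by simp
  thus ?thesis by (simp add: theta_product_def)
qed

text \<open>For M = i + 2kn the substitution L = u + n turns the exponent of q into 2k L(L-1)/2 + iL
  plus a constant, and the sum over L is the triple product in base q^(2k) at q^i.\<close>

lemma theta_term_has_sum:
  assumes "k \<ge> 1"
  shows "(theta_term k (int (i + 2 * k * n)) has_sum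
    ((- 1) ^ i * (- 1) ^ n * q ^ ((i choose 2) + (2 * k - 1) * (k * n + i) * n) * theta_product k i)) UNIV"
proof -
  define c where "c = (- 1) ^ i * (- 1) ^ n * q ^ ((i choose 2) + (2 * k - 1) * (k * n + i) * n)"
  define M where "M = int (i + 2 * k * n)"
  interpret p: qseries "q ^ (2 * k)"
    using assms by (intro qseries_power) simp
  have "((\<lambda>L. (- 1) powi L * (q ^ (2 * k)) ^ int_choose2 L * (q ^ i) powi L) has_sum theta_product k i) UNIV"
    unfolding theta_product_def by (rule p.jacobi_triple_product) (simp add: q_nonzero)
  from has_sum_cmult_right[OF has_sum_int_shift[OF this, of "int n"], of c]
  have "((\<lambda>u. c * ((- 1) powi (u + int n) * (q ^ (2 * k)) ^ int_choose2 (u + int n) * (q ^ i) powi (u + int n))) has_sum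
      c * theta_product k i) UNIV" .
  also have "(\<lambda>u. c * ((- 1) powi (u + int n) * (q ^ (2 * k)) ^ int_choose2 (u + int n) * (q ^ i) powi (u + int n))) =
      theta_term k M"
  proof
    fix u :: int
    \<comment> \<open>Written so that the sign visibly differs from (-1)^(u+n) by (-1)^(i+n) and an
      even power.\<close>
    have "M + u = int i + int n + (u + int n) + 2 * (int k * int n - int n)"
      by (simp add: M_def)
    hence "(- 1 :: complex) powi (M + u) = (- 1) powi (int i + int n + (u + int n)) * (- 1) powi (2 * (int k * int n - int n))"
      by (simp only:) (rule power_int_add, simp)
    also have "\<dots> = (- 1) ^ i * (- 1) ^ n * (- 1) powi (u + int n)"
      unfolding minus_one_powi_even by (simp add: power_int_add)
    finally have sgn: "(- 1 :: complex) powi (M + u) = (- 1) ^ i * (- 1) ^ n * (- 1) powi (u + int n)" .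
    have k': "int (2 * k - 1) = 2 * int k - 1" using assms by simp
    have i': "i choose 2 = int_choose2 (int i)"
      by (cases i) (simp_all only: int_choose2_Suc triangle_eq_choose, simp add: int_choose2_def)
    \<comment> \<open>The exponent identity is checked over the integers and doubled, where
      \<open>two_times_int_choose2\<close> turns it into a polynomial identity.\<close>
    have "2 * int (int_choose2 (M + u) + (2 * k - 1) * int_choose2 u) =
        2 * int (int_choose2 (M + u)) + (2 * int k - 1) * (2 * int (int_choose2 u))"
      unfolding of_nat_add of_nat_mult k' by (simp only: ring_distribs mult_ac)
    also have "\<dots> = 2 * int (int_choose2 (int i)) + 2 * ((2 * int k - 1) * (int k * int n + int i) * int n) +
        2 * int k * (2 * int (int_choose2 (u + int n))) + 2 * (int i * (u + int n))"
      unfolding two_times_int_choose2 M_def of_nat_add of_nat_mult of_nat_numeral by (simp add: algebra_simps)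
    also have "\<dots> = 2 * (int ((i choose 2) + (2 * k - 1) * (k * n + i) * n) + int (2 * k * int_choose2 (u + int n)) + int i * (u + int n))"
      unfolding of_nat_add of_nat_mult of_nat_numeral k' i' by (simp only: ring_distribs mult_ac)
    finally have e: "int (int_choose2 (M + u) + (2 * k - 1) * int_choose2 u) =
        int ((i choose 2) + (2 * k - 1) * (k * n + i) * n) + int (2 * k * int_choose2 (u + int n)) + int i * (u + int n)"
      by simp
    have "q ^ (int_choose2 (M + u) + (2 * k - 1) * int_choose2 u) =
        q powi int (int_choose2 (M + u) + (2 * k - 1) * int_choose2 u)"
      by (simp only: power_int_of_nat)
    also have "\<dots> = q powi int ((i choose 2) + (2 * k - 1) * (k * n + i) * n) * q powi int (2 * k * int_choose2 (u + int n)) *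
        q powi (int i * (u + int n))"
      unfolding e using q_nonzero by (simp only: power_int_add simp_thms)
    also have "\<dots> = q ^ ((i choose 2) + (2 * k - 1) * (k * n + i) * n) * (q ^ (2 * k)) ^ int_choose2 (u + int n) *
        (q ^ i) powi (u + int n)"
      by (simp only: power_int_of_nat powi_int_mult power_mult[of q "2 * k"])
    finally show "c * ((- 1) powi (u + int n) * (q ^ (2 * k)) ^ int_choose2 (u + int n) * (q ^ i) powi (u + int n)) = theta_term k M u"
      unfolding theta_term_def sgn c_def by (simp only: mult_ac)
  qed
  finally show ?thesis by (simp add: c_def M_def)
qed

lemma theta_term_summable:
  assumes "k \<ge> 1"
  shows "(\<lambda>n. theta_term k M (- int n)) summable_on UNIV"
proof (rule summable_on_norm_bound)
  show "(\<lambda>n. norm q ^ triangle n) summable_on UNIV"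
    using summable_power_times_triangle[of 1 "norm q"] norm_q by (subst summable_on_UNIV_nonneg_real_iff) auto
  fix n
  have "triangle n \<le> int_choose2 (M + - int n) + (2 * k - 1) * triangle n"
    using assms by (cases k) auto
  hence "norm q ^ (int_choose2 (M + - int n) + (2 * k - 1) * triangle n) \<le> norm q ^ triangle n"
    using norm_q by (intro power_decreasing) auto
  thus "norm (theta_term k M (- int n)) \<le> norm q ^ triangle n"
    by (simp add: theta_term_def norm_mult norm_power norm_power_int)
qed

lemma partial_theta_summand_summable:
  assumes "k \<ge> 1"
  shows "(\<lambda>s. (- 1) ^ s * q ^ (k * (s\<^sup>2 + s) + s * N)) summable_on UNIV"
proof (rule summable_on_norm_bound)
  show "(\<lambda>s. norm q ^ s) summable_on UNIV"
    using norm_q by (subst summable_on_UNIV_nonneg_real_iff) (auto intro: summable_geometric)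
  fix s
  have "s \<le> k * (s\<^sup>2 + s) + s * N"
    using assms by (cases k) auto
  thus "norm ((- 1) ^ s * q ^ (k * (s\<^sup>2 + s) + s * N)) \<le> norm q ^ s"
    using norm_q by (simp add: norm_mult norm_power power_decreasing)
qed

text \<open>For M = -N and u = -n both binomials are triangular numbers, of index N + n and n, so
  \<open>theta_exponent_eq\<close> applies termwise. The two sides of the theorem thus have equal
  coefficients at a^M for M <= 0.\<close>

lemma partial_theta_nonpos:
  assumes "k \<ge> 1"
  shows "(\<Sum>\<^sub>\<infinity>n. theta_term k (- int N) (- int n)) = partial_theta k N"
proof -
  have "theta_term k (- int N) (- int n) = (- 1) ^ N * q ^ triangle N * ((- 1) ^ n * q ^ (k * (n\<^sup>2 + n) + n * N))" for n
  proof -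
    have s: "- int N + - int n = - int (N + n)" by simp
    have "(- 1 :: complex) powi (- int (N + n)) = (- 1) ^ (N + n)"
      unfolding power_int_minus power_int_of_nat power_inverse [symmetric] by simp
    thus ?thesis
      unfolding theta_term_def s int_choose2_minus theta_exponent_eq[OF assms] power_add by (simp only: mult_ac)
  qed
  thus ?thesis
    by (simp add: partial_theta_def infsum_cmult_right')
qed

text \<open>For M > 0 the terms with u = s + 1 >= 1 are the negatives of the terms of the partial
  theta function, the shift by one costing a sign. Adding the terms with u <= 0 gives the complete
  theta function.\<close>

lemma partial_theta_pos:
  assumes "k \<ge> 1"
  shows "(theta_term k (int (Suc N)) has_sum
    ((\<Sum>\<^sub>\<infinity>n. theta_term k (int (Suc N)) (- int n)) - partial_theta k (Suc N))) UNIV"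
proof -
  let ?M = "Suc N"
  have "theta_term k (int ?M) (int (Suc s)) = - ((- 1) ^ ?M * q ^ triangle ?M) * ((- 1) ^ s * q ^ (k * (s\<^sup>2 + s) + s * ?M))" for s
  proof -
    have s: "int ?M + int (Suc s) = int (Suc (?M + s))" by simp
    have m: "(- 1 :: complex) ^ Suc (?M + s) = - ((- 1) ^ ?M * (- 1) ^ s)" by (simp add: power_add)
    show ?thesis
      unfolding theta_term_def s int_choose2_Suc theta_exponent_eq[OF assms] power_int_of_nat m power_add[of q]
      by (simp only: mult_minus_left mult_minus_right mult_ac)
  qed
  hence "((\<lambda>s. theta_term k (int ?M) (int (Suc s))) has_sum (- ((- 1) ^ ?M * q ^ triangle ?M) *
      (\<Sum>\<^sub>\<infinity>s. (- 1) ^ s * q ^ (k * (s\<^sup>2 + s) + s * ?M)))) UNIV"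
    using has_sum_cmult_right[OF has_sum_infsum[OF partial_theta_summand_summable[OF assms, of ?M]],
        of "- ((- 1) ^ ?M * q ^ triangle ?M)"] by (simp only:)
  from has_sum_int_split[OF this has_sum_infsum[OF theta_term_summable[OF assms]]]
  show ?thesis
    by (simp only: partial_theta_def mult_minus_left add.commute diff_conv_add_uminus)
qed

lemma summable_on_power_times_triangle:
  assumes "k \<ge> 1"
  shows "(\<lambda>n. a ^ n * q ^ ((2 * k - 1) * triangle n)) summable_on UNIV"
proof (rule summable_on_norm_bound)
  show "(\<lambda>n. norm a ^ n * norm q ^ triangle n) summable_on UNIV"
    using summable_power_times_triangle[of "norm a" "norm q"] norm_q
    by (subst summable_on_UNIV_nonneg_real_iff) auto
  fix n
  have "triangle n \<le> (2 * k - 1) * triangle n"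
    using assms by (cases k) auto
  hence "norm a ^ n * norm q ^ ((2 * k - 1) * triangle n) \<le> norm a ^ n * norm q ^ triangle n"
    using norm_q by (intro mult_left_mono power_decreasing) auto
  thus "norm (a ^ n * q ^ ((2 * k - 1) * triangle n)) \<le> norm a ^ n * norm q ^ triangle n"
    by (simp add: norm_mult norm_power)
qed

text \<open>Multiply the triple product series by the series in a^n and collect the coefficient of
  a^M in the other order of summation.\<close>

lemma false_theta_has_sum:
  assumes "a \<noteq> 0" "k \<ge> 1"
  shows "\<exists>S. ((\<lambda>n. (qfac_inf * qpoch_inf a q * qpoch_inf (q / a) q) * (a ^ n * q ^ ((2 * k - 1) * triangle n))) has_sum S) UNIV \<and>
    ((\<lambda>M. a powi M * (\<Sum>\<^sub>\<infinity>n. theta_term k M (- int n))) has_sum S) UNIV"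
proof -
  let ?J = "qfac_inf * qpoch_inf a q * qpoch_inf (q / a) q"
  define g where "g = (\<lambda>L. (- 1) powi L * q ^ int_choose2 L * a powi L)"
  define h where "h = (\<lambda>n. a ^ n * q ^ ((2 * k - 1) * triangle n))"
  let ?f = "\<lambda>n M. a powi M * theta_term k M (- int n)"
  have J: "(g has_sum ?J) UNIV"
    unfolding g_def by (rule jacobi_triple_product[OF assms(1)])
  have f: "?f n M = h n * g (M + - int n)" for n M
  proof -
    have "a powi M = a powi (int n + (M + - int n))" by simp
    also have "\<dots> = a ^ n * a powi (M + - int n)"
      using assms(1) by (simp only: power_int_add power_int_of_nat simp_thms)
    finally show ?thesis
      unfolding theta_term_def g_def h_def int_choose2_minus power_add by (simp only: mult_ac)
  qed
  have "(\<lambda>n. norm (h n)) summable_on UNIV"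
    using summable_on_power_times_triangle[OF assms(2), of a] unfolding h_def summable_on_iff_abs_summable_on_complex .
  moreover have "(\<lambda>L. norm (g L)) summable_on UNIV"
    using has_sum_imp_summable[OF J] unfolding summable_on_iff_abs_summable_on_complex .
  ultimately have "(\<lambda>(n, L). norm (h n) * norm (g L)) summable_on UNIV \<times> UNIV"
    by (rule summable_on_mult_Times) auto
  hence "(\<lambda>(n, L). h n * g L) summable_on UNIV \<times> UNIV"
    by (rule summable_on_norm_bound) (auto simp: norm_mult)
  \<comment> \<open>The shear L = M - n carries the product of two absolutely convergent series to
    the double series indexed by n and the total exponent M of a.\<close>
  moreover have "bij_betw (\<lambda>(n, M). (n, M + - int n)) (UNIV \<times> UNIV) (UNIV \<times> UNIV)"
    by (rule bij_betwI[of _ _ _ "\<lambda>(n, M). (n, M + int n)"]) auto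
  ultimately have "(\<lambda>p. case (case p of (n, M) \<Rightarrow> (n, M + - int n)) of (n, L) \<Rightarrow> h n * g L) summable_on UNIV \<times> UNIV"
    by (simp add: summable_on_reindex_bij_betw)
  hence "(\<lambda>(n, M). ?f n M) summable_on UNIV \<times> UNIV"
    unfolding f by (simp add: case_prod_unfold)
  then obtain S where S: "((\<lambda>(n, M). ?f n M) has_sum S) (UNIV \<times> UNIV)"
    by (auto simp: summable_on_def)
  have row: "((\<lambda>M. ?f n M) has_sum ?J * h n) UNIV" for n
    unfolding f using has_sum_cmult_right[OF has_sum_int_shift[OF J, of "- int n"], of "h n"] by (simp only: mult.commute)
  have 1: "((\<lambda>n. ?J * h n) has_sum S) UNIV"
    using S by (rule has_sum_Sigma') (use row in simp)
  have "((\<lambda>(M, n). ?f n M) has_sum S) (UNIV \<times> UNIV)"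
    using has_sum_swap[THEN iffD1, OF S] by simp
  hence "((\<lambda>M. a powi M * (\<Sum>\<^sub>\<infinity>n. theta_term k M (- int n))) has_sum S) UNIV"
  proof (rule has_sum_Sigma')
    fix M :: int
    have "((\<lambda>n. ?f n M) has_sum a powi M * (\<Sum>\<^sub>\<infinity>n. theta_term k M (- int n))) UNIV"
      by (rule has_sum_cmult_right[OF has_sum_infsum[OF theta_term_summable[OF assms(2)]]])
    thus "((\<lambda>n. case (M, n) of (M, n) \<Rightarrow> ?f n M) has_sum a powi M * (\<Sum>\<^sub>\<infinity>n. theta_term k M (- int n))) UNIV"
      by simp
  qed
  with 1 show ?thesis unfolding h_def by blast
qed

lemma summable_on_theta_series:
  assumes "k \<ge> 1"
  shows "(\<lambda>n. (- 1) ^ n * a ^ (2 * k * n) * q ^ ((2 * k - 1) * (k * n + i) * n)) summable_on UNIV"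
proof (rule summable_on_norm_bound)
  show "(\<lambda>n. (norm a ^ (2 * k)) ^ n * norm q ^ triangle n) summable_on UNIV"
    using summable_power_times_triangle[of "norm a ^ (2 * k)" "norm q"] norm_q
    by (subst summable_on_UNIV_nonneg_real_iff) auto
  fix n
  have "triangle n \<le> 1 * (1 * n + 0) * n"
    using triangle_le_square[of n] by simp
  also have "\<dots> \<le> (2 * k - 1) * (k * n + i) * n"
    using assms by (intro mult_mono add_mono) auto
  finally have "norm a ^ (2 * k * n) * norm q ^ ((2 * k - 1) * (k * n + i) * n) \<le> norm a ^ (2 * k * n) * norm q ^ triangle n"
    using norm_q by (intro mult_left_mono power_decreasing) auto
  thus "norm ((- 1) ^ n * a ^ (2 * k * n) * q ^ ((2 * k - 1) * (k * n + i) * n)) \<le> (norm a ^ (2 * k)) ^ n * norm q ^ triangle n"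
    by (simp add: norm_mult norm_power power_mult)
qed

text \<open>The difference of the coefficients vanishes for M <= 0. For M = i + 2kn > 0 with 0 <= i
  < 2k it is minus a complete theta function, hence minus \<open>theta_product k i\<close> times a
  monomial; grouping by i gives the finite sum.\<close>

lemma positive_part_has_sum:
  assumes "a \<noteq> 0" "k \<ge> 1"
    and "((\<lambda>M. a powi M * partial_theta k (nat \<bar>M\<bar>)) has_sum S) UNIV"
    and "((\<lambda>M. a powi M * (\<Sum>\<^sub>\<infinity>n. theta_term k M (- int n))) has_sum T) UNIV"
  shows "S - T = (\<Sum>i<2 * k. (- 1) ^ (i + 1) * a ^ i * q ^ (i choose 2) * theta_product k i *
    (\<Sum>\<^sub>\<infinity>n. (- 1) ^ n * a ^ (2 * k * n) * q ^ ((2 * k - 1) * (k * n + i) * n)))"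
proof -
  let ?U = "\<lambda>M. \<Sum>\<^sub>\<infinity>n. theta_term k M (- int n)"
  define c where "c = (\<lambda>i n. (- 1) ^ i * (- 1) ^ n * q ^ ((i choose 2) + (2 * k - 1) * (k * n + i) * n) * theta_product k i)"
  define d where "d = (\<lambda>M. a powi M * (partial_theta k (nat \<bar>M\<bar>) - ?U M))"
  have "((\<lambda>M. a powi M * partial_theta k (nat \<bar>M\<bar>) + (- 1) * (a powi M * ?U M)) has_sum (S + (- 1) * T)) UNIV"
    by (intro has_sum_add has_sum_cmult_right assms)
  hence d: "(d has_sum (S - T)) UNIV"
    by (simp add: d_def right_diff_distrib)
  have d_nonpos: "d (- int N) = 0" for N
    using partial_theta_nonpos[OF assms(2), of N] by (simp add: d_def)
  \<comment> \<open>The case i = n = 0 is outside the reach of \<open>partial_theta_pos\<close>;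
    there both sides are 0, the right one by \<open>theta_product_0\<close>.\<close>
  have d_eq: "d (int (i + 2 * k * n)) = - (a ^ (i + 2 * k * n) * c i n)" for i n
  proof (cases "i + 2 * k * n")
    case 0
    have "d (int (i + 2 * k * n)) = d (- int 0)"
      unfolding 0 by simp
    moreover have "i = 0" using 0 by simp
    ultimately show ?thesis
      using d_nonpos[of 0] theta_product_0[OF assms(2)] by (simp add: c_def)
  next
    case (Suc N)
    have "(theta_term k (int (Suc N)) has_sum c i n) UNIV"
      using theta_term_has_sum[OF assms(2), of i n] unfolding Suc c_def .
    hence "?U (int (Suc N)) - partial_theta k (Suc N) = c i n"
      using partial_theta_pos[OF assms(2), of N] has_sum_unique by blast
    hence "partial_theta k (Suc N) - ?U (int (Suc N)) = - c i n"
      by (simp add: algebra_simps)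
    moreover have "nat \<bar>int (Suc N)\<bar> = Suc N" by simp
    ultimately show ?thesis
      unfolding Suc d_def by (simp only: power_int_of_nat mult_minus_right)
  qed
  have "(d has_sum (S - T)) (range int)"
  proof (rule has_sum_cong_neutral[THEN iffD1, OF _ _ _ d])
    fix M :: int assume "M \<in> UNIV - range int"
    hence "M < 0" by (metis Diff_iff nonneg_int_cases not_less rangeI)
    hence "M = - int (nat (- M))" by simp
    thus "d M = 0" using d_nonpos by metis
  qed auto
  hence "((d \<circ> int) has_sum (S - T)) UNIV"
    by (subst has_sum_reindex [symmetric]) auto
  \<comment> \<open>Division with remainder by 2k: every M >= 0 is uniquely i + 2kn with i <
    2k.\<close>
  moreover have "bij_betw (\<lambda>(i, n). i + 2 * k * n) ({..<2 * k} \<times> UNIV) UNIV"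
    using assms(2) by (intro bij_betwI[of _ _ _ "\<lambda>m. (m mod (2 * k), m div (2 * k))"]) auto
  ultimately have "((\<lambda>p. (d \<circ> int) (case p of (i, n) \<Rightarrow> i + 2 * k * n)) has_sum (S - T)) ({..<2 * k} \<times> UNIV)"
    using has_sum_reindex_bij_betw by blast
  hence "((\<lambda>i. (- 1) ^ (i + 1) * a ^ i * q ^ (i choose 2) * theta_product k i *
      (\<Sum>\<^sub>\<infinity>n. (- 1) ^ n * a ^ (2 * k * n) * q ^ ((2 * k - 1) * (k * n + i) * n))) has_sum (S - T)) {..<2 * k}"
  proof (rule has_sum_Sigma')
    fix i
    have "((\<lambda>n. (- 1) ^ (i + 1) * a ^ i * q ^ (i choose 2) * theta_product k i *
        ((- 1) ^ n * a ^ (2 * k * n) * q ^ ((2 * k - 1) * (k * n + i) * n))) has_sum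
        ((- 1) ^ (i + 1) * a ^ i * q ^ (i choose 2) * theta_product k i *
          (\<Sum>\<^sub>\<infinity>n. (- 1) ^ n * a ^ (2 * k * n) * q ^ ((2 * k - 1) * (k * n + i) * n)))) UNIV"
      by (rule has_sum_cmult_right[OF has_sum_infsum[OF summable_on_theta_series[OF assms(2)]]])
    also have "(\<lambda>n. (- 1) ^ (i + 1) * a ^ i * q ^ (i choose 2) * theta_product k i *
        ((- 1) ^ n * a ^ (2 * k * n) * q ^ ((2 * k - 1) * (k * n + i) * n))) =
        (\<lambda>n. (d \<circ> int) (case (i, n) of (i, n) \<Rightarrow> i + 2 * k * n))"
    proof
      fix n
      have "(d \<circ> int) (case (i, n) of (i, n) \<Rightarrow> i + 2 * k * n) = - (a ^ (i + 2 * k * n) * c i n)"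
        unfolding o_def prod.case by (rule d_eq)
      also have "\<dots> = (- 1) ^ (i + 1) * a ^ i * q ^ (i choose 2) * theta_product k i *
          ((- 1) ^ n * a ^ (2 * k * n) * q ^ ((2 * k - 1) * (k * n + i) * n))"
        unfolding c_def power_add[of a] power_add[of q] Suc_eq_plus1 [symmetric] power_Suc[of "-1"]
        by (simp only: mult_minus_left mult_minus_right mult_1_left mult_ac)
      finally show "(- 1) ^ (i + 1) * a ^ i * q ^ (i choose 2) * theta_product k i *
          ((- 1) ^ n * a ^ (2 * k * n) * q ^ ((2 * k - 1) * (k * n + i) * n)) =
          (d \<circ> int) (case (i, n) of (i, n) \<Rightarrow> i + 2 * k * n)" ..
    qed
    finally show "((\<lambda>n. (d \<circ> int) (case (i, n) of (i, n) \<Rightarrow> i + 2 * k * n)) has_sum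
        ((- 1) ^ (i + 1) * a ^ i * q ^ (i choose 2) * theta_product k i *
          (\<Sum>\<^sub>\<infinity>n. (- 1) ^ n * a ^ (2 * k * n) * q ^ ((2 * k - 1) * (k * n + i) * n)))) UNIV" .
  qed
  moreover have "((\<lambda>i. (- 1) ^ (i + 1) * a ^ i * q ^ (i choose 2) * theta_product k i *
      (\<Sum>\<^sub>\<infinity>n. (- 1) ^ n * a ^ (2 * k * n) * q ^ ((2 * k - 1) * (k * n + i) * n))) has_sum
      (\<Sum>i<2 * k. (- 1) ^ (i + 1) * a ^ i * q ^ (i choose 2) * theta_product k i *
        (\<Sum>\<^sub>\<infinity>n. (- 1) ^ n * a ^ (2 * k * n) * q ^ ((2 * k - 1) * (k * n + i) * n)))) {..<2 * k}"
    by (rule has_sum_finite) simp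
  ultimately show ?thesis
    using has_sum_unique by blast
qed

end

section \<open>Assembly: division by the theta product and comparison of both sides\<close>

theorem theorem1p2:
  fixes q a :: complex and k \<kappa> :: nat
  assumes "0 < norm q" and "norm q < 1"
    and "a \<noteq> 0" and "a \<notin> range (\<lambda>m::int. q powi m)"
    and "k \<ge> 1" and "\<kappa> = 2 * k"
  shows "summable (\<lambda>n. qpoch q q (2 * int n) * q ^ n /
            (qpoch a q (int n + 1) * qpoch (q / a) q (int n)) * inner_sum q k n) \<and>
         summable (\<lambda>n. a ^ n * q ^ ((\<kappa> - 1) * ((n + 1) choose 2))) \<and>
         (\<forall>i\<in>{1..\<kappa> - 1}.
            summable (\<lambda>n. (- 1) ^ n * a ^ (\<kappa> * n) * q ^ ((\<kappa> - 1) * (k * n + i) * n))) \<and>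
         (\<Sum>n. qpoch q q (2 * int n) * q ^ n /
            (qpoch a q (int n + 1) * qpoch (q / a) q (int n)) * inner_sum q k n) =
         (\<Sum>n. a ^ n * q ^ ((\<kappa> - 1) * ((n + 1) choose 2))) +
         (\<Sum>i = 1..\<kappa> - 1. (- 1) ^ (i + 1) * a ^ i * q ^ (i choose 2) *
            (qpoch_inf (q ^ i) (q ^ \<kappa>) * qpoch_inf (q ^ (\<kappa> - i)) (q ^ \<kappa>) * qpoch_inf (q ^ \<kappa>) (q ^ \<kappa>) /
              (qpoch_inf q q * qpoch_inf a q * qpoch_inf (q / a) q)) *
            (\<Sum>n. (- 1) ^ n * a ^ (\<kappa> * n) * q ^ ((\<kappa> - 1) * (k * n + i) * n)))"
proof -
  interpret qseries q
    using assms(1,2) by unfold_locales auto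
  obtain K where K: "k = Suc K"
    using assms(5) by (cases k) auto
  define J where "J = qfac_inf * qpoch_inf a q * qpoch_inf (q / a) q"
  \<comment> \<open>The infinite products vanish only where a is an integer power of q: exponents -j
    <= 0 here, and j + 1 >= 1 for q/a.\<close>
  have A: "qpoch_inf a q \<noteq> 0"
  proof
    assume "qpoch_inf a q = 0"
    then obtain j where "a * q ^ j = 1"
      using qpoch_inf_eq_0_iff[OF norm_q] by blast
    hence "a = q powi (- int j)"
      using q_nonzero by (simp add: power_int_minus field_simps)
    thus False using assms(4) by blast
  qed
  have A': "qpoch_inf (q / a) q \<noteq> 0"
  proof
    assume "qpoch_inf (q / a) q = 0"
    then obtain j where "q / a * q ^ j = 1"
      using qpoch_inf_eq_0_iff[OF norm_q] by blast
    hence "a = q powi int (Suc j)"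
      using assms(3) unfolding power_int_of_nat by (simp add: field_simps)
    thus False using assms(4) by blast
  qed
  have J: "J \<noteq> 0"
    using A A' qfac_inf_nonzero by (simp add: J_def)
  let ?L = "\<lambda>n. qpoch q q (2 * int n) * q ^ n / (qpoch a q (int n + 1) * qpoch (q / a) q (int n)) * inner_sum q k n"
  let ?R = "\<lambda>n. a ^ n * q ^ ((\<kappa> - 1) * ((n + 1) choose 2))"
  let ?T = "\<lambda>i n. (- 1) ^ n * a ^ (\<kappa> * n) * q ^ ((\<kappa> - 1) * (k * n + i) * n)"
  obtain S where S: "((\<lambda>n. qfac (2 * n) * q ^ n * bailey_beta K n * theta n a) has_sum S) UNIV"
    "((\<lambda>M. a powi M * partial_theta (Suc K) (nat \<bar>M\<bar>)) has_sum S) UNIV"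
    using partial_theta_has_sum[OF assms(3)] by blast
  obtain T where T: "((\<lambda>n. J * (a ^ n * q ^ ((2 * k - 1) * triangle n))) has_sum T) UNIV"
    "((\<lambda>M. a powi M * (\<Sum>\<^sub>\<infinity>n. theta_term k M (- int n))) has_sum T) UNIV"
    using false_theta_has_sum[OF assms(3,5)] unfolding J_def by blast
  \<comment> \<open>The quotients of infinite products that define the two finite symbols cancel
    against \<open>J\<close> and leave the product evaluated in \<open>theta_eq\<close>.\<close>
  have "?L n = 1 / J * (qfac (2 * n) * q ^ n * bailey_beta K n * theta n a)" for n
  proof -
    have "qpoch q q (2 * int n) = qfac (2 * n)"
      using qpoch_self_eq_qfac[of "2 * n"] by simp
    moreover have "qpoch a q (int n + 1) = qpoch_inf a q / qpoch_inf (a * q ^ Suc n) q"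
      by (simp add: qpoch_def power_int_add q_nonzero mult_ac)
    moreover have "qpoch (q / a) q (int n) = qpoch_inf (q / a) q / qpoch_inf (q ^ Suc n / a) q"
      by (simp add: qpoch_def)
    ultimately show ?thesis
      using A A' qfac_inf_nonzero by (simp add: K inner_sum_eq_bailey_beta theta_eq[OF assms(3)] J_def)
  qed
  hence L: "(?L has_sum (1 / J * S)) UNIV"
    using has_sum_cmult_right[OF S(1), of "1 / J"] by (simp only:)
  have "?R n = 1 / J * (J * (a ^ n * q ^ ((2 * k - 1) * triangle n)))" for n
    using J by (simp add: assms(6) triangle_eq_choose)
  hence R: "(?R has_sum (1 / J * T)) UNIV"
    using has_sum_cmult_right[OF T(1), of "1 / J"] by (simp only:)
  have T_summable: "?T i summable_on UNIV" for i
    using summable_on_theta_series[OF assms(5), of a i] by (simp only: assms(6))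
  have T_suminf: "suminf (?T i) = infsum (?T i) UNIV" for i
    using has_sum_imp_sums[OF has_sum_infsum[OF T_summable[of i]]] by (rule sums_unique [symmetric])
  have prod: "theta_product k i = qpoch_inf (q ^ i) (q ^ \<kappa>) * qpoch_inf (q ^ (\<kappa> - i)) (q ^ \<kappa>) * qpoch_inf (q ^ \<kappa>) (q ^ \<kappa>)"
    if "i \<in> {1..\<kappa> - 1}" for i
  proof -
    have "q ^ \<kappa> / q ^ i = q ^ (\<kappa> - i)"
      using that q_nonzero by (subst power_diff) auto
    thus ?thesis by (simp add: theta_product_def assms(6) mult_ac)
  qed
  have "1 / J * S = 1 / J * T + 1 / J * (S - T)"
    by (simp add: diff_divide_distrib)
  also have "S - T = (\<Sum>i<2 * k. (- 1) ^ (i + 1) * a ^ i * q ^ (i choose 2) * theta_product k i * infsum (?T i) UNIV)"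
    unfolding assms(6) by (rule positive_part_has_sum[OF assms(3,5) S(2)[folded K] T(2)])
  also have "\<dots> = (\<Sum>i = 1..\<kappa> - 1. (- 1) ^ (i + 1) * a ^ i * q ^ (i choose 2) * theta_product k i * infsum (?T i) UNIV)"
  \<comment> \<open>The sum over residues starts at i = 0, the stated one at i = 1; the extra term
    is zero by \<open>theta_product_0\<close>.\<close>
  proof (rule sum.mono_neutral_right)
    show "\<forall>i\<in>{..<2 * k} - {1..\<kappa> - 1}. (- 1) ^ (i + 1) * a ^ i * q ^ (i choose 2) * theta_product k i * infsum (?T i) UNIV = 0"
    proof
      fix i assume "i \<in> {..<2 * k} - {1..\<kappa> - 1}"
      hence "i = 0" by (auto simp: assms(6))
      thus "(- 1) ^ (i + 1) * a ^ i * q ^ (i choose 2) * theta_product k i * infsum (?T i) UNIV = 0"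
        using theta_product_0[OF assms(5)] by simp
    qed
  qed (use assms(5) in \<open>auto simp: assms(6)\<close>)
  also have "1 / J * \<dots> = (\<Sum>i = 1..\<kappa> - 1. (- 1) ^ (i + 1) * a ^ i * q ^ (i choose 2) *
      (qpoch_inf (q ^ i) (q ^ \<kappa>) * qpoch_inf (q ^ (\<kappa> - i)) (q ^ \<kappa>) * qpoch_inf (q ^ \<kappa>) (q ^ \<kappa>) /
        (qpoch_inf q q * qpoch_inf a q * qpoch_inf (q / a) q)) * suminf (?T i))"
    unfolding sum_distrib_left T_suminf J_def [symmetric]
    by (rule sum.cong[OF refl]) (simp only: prod times_divide_eq_right times_divide_eq_left mult_1_left)
  finally have "1 / J * S = 1 / J * T + (\<Sum>i = 1..\<kappa> - 1. (- 1) ^ (i + 1) * a ^ i * q ^ (i choose 2) *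
      (qpoch_inf (q ^ i) (q ^ \<kappa>) * qpoch_inf (q ^ (\<kappa> - i)) (q ^ \<kappa>) * qpoch_inf (q ^ \<kappa>) (q ^ \<kappa>) /
        (qpoch_inf q q * qpoch_inf a q * qpoch_inf (q / a) q)) * suminf (?T i))" .
  moreover have "summable ?L" "suminf ?L = 1 / J * S"
    using has_sum_imp_sums[OF L] by (simp_all only: sums_iff)
  moreover have "summable ?R" "suminf ?R = 1 / J * T"
    using has_sum_imp_sums[OF R] by (simp_all only: sums_iff)
  moreover have "\<forall>i\<in>{1..\<kappa> - 1}. summable (?T i)"
    using summable_on_imp_summable[OF T_summable] by blast
  ultimately show ?thesis by (simp only: simp_thms)
qed

end
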